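(* Let $f:\hat{\mathbb{C}}\to\hat{\mathbb{C}}$ be a bicritical rational map of even degree $d$. (1) For each $k\in\mathbb{N}$, $\mathrm{Deck}(f^k)$ is isomorphic to either $D_{2d}$, $D_{4d}$, or $\mathbb{Z}_{d^n}$ for some $n\ge 1$. (2) Furthermore, if $f$ is not a power map then $|\mathrm{Deck}(f^k)|\le 4d$ for each $k\in\mathbb{N}$.
   Context: $\hat{\mathbb{C}}$ is the Riemann sphere, $\mathbb{N}=\{1,2,\dots\}$, and $f^k$ is the $k$-th iterate of $f$. For a rational map $f$, $\mathcal{C}_f$ is its set of critical points in $\hat{\mathbb{C}}$ and $\mathcal{V}_f=f(\mathcal{C}_f)$ its set of critical values. $f$ is bicritical if $|\mathcal{C}_f|=2$ (then $|\mathcal{V}_f|=2$ and $\deg f\ge 2$). A bicritical rational map $f$ is called a power map if $\mathcal{C}_f=\mathcal{V}_f$; equivalently, $f$ is conjugate by a Möbius transformation to $z\mapsto z^{d}$ or $z\mapsto z^{-d}$ for some $d\ge 2$. The deck group of a rational map $F$ is $\mathrm{Deck}(F)=\{\mu \text{ a Möbius transformation of } \hat{\mathbb{C}} : F\circ\mu=F\}$, a group under composition. $\mathbb{Z}_n$ is the cyclic group of order $n$. For $n\ge2$, $D_{2n}=\langle R,F\mid R^n=F^2=(RF)^2=\mathrm{id}\rangle$ is the dihedral group of order $2n$; in particular $D_4$ is the Klein four-group. *)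

theory Defs
  imports "HOL-Analysis.Analysis" "HOL-Computational_Algebra.Polynomial_Factorial"
    "HOL-Computational_Algebra.Field_as_Ring"
    "HOL-Algebra.Elementary_Groups"
begin

section \<open>Rational maps of the Riemann sphere\<close>

text \<open>The Riemann sphere is the one-point compactification of the complex plane:
  \<^const>\<open>None\<close> is the point at infinity.\<close>

type_synonym sphere = "complex option"

text \<open>The map \<open>p/q\<close>. At infinity it takes the limit of \<open>p z / q z\<close>, which is the quotient of
  the coefficients of \<open>z^m\<close>, where \<open>m\<close> is the larger of the two degrees. The definition is
  meaningful only when \<open>p\<close> and \<open>q\<close> have no common zero.\<close>

definition rat_map :: "complex poly \<Rightarrow> complex poly \<Rightarrow> sphere \<Rightarrow> sphere" where
  "rat_map p q x =
     (case x of
        Some z \<Rightarrow> if poly q z = 0 then None else Some (poly p z / poly q z)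
      | None \<Rightarrow>
          let m = max (degree p) (degree q)
          in if coeff q m = 0 then None else Some (coeff p m / coeff q m))"

definition rational_map :: "(sphere \<Rightarrow> sphere) \<Rightarrow> bool" where
  "rational_map f \<longleftrightarrow> (\<exists>p q. coprime p q \<and> f = rat_map p q)"

definition rat_degree :: "(sphere \<Rightarrow> sphere) \<Rightarrow> nat" where
  "rat_degree f =
     (THE n. \<exists>p q. coprime p q \<and> f = rat_map p q \<and> n = max (degree p) (degree q))"

lemma rat_map_eq_imp_cross_eq:
  assumes "rat_map p q = rat_map p' q'"
  shows "p * q' = p' * q"
proof -
  have "poly (p * q') z = poly (p' * q) z" for z
    using fun_cong[OF assms, of "Some z"]
    by (auto simp: rat_map_def field_simps split: if_splits)
  then show ?thesis
    using poly_eq_poly_eq_iff by blast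
qed

lemma coprime_cross_eq_imp_degree_eq:
  fixes p q p' q' :: "complex poly"
  assumes "coprime p q" "coprime p' q'" "p * q' = p' * q"
  shows "degree p = degree p'"
proof -
  have "p dvd p' * q" "p' dvd p * q'"
    using assms(3) by (metis dvd_triv_left)+
  then have "p dvd p'" "p' dvd p"
    using assms(1,2) by (simp_all add: coprime_dvd_mult_left_iff)
  then show ?thesis
    by (metis dvd_0_left_iff dvd_imp_degree_le le_antisym)
qed

lemma rat_degree_rat_map:
  assumes "coprime p q"
  shows "rat_degree (rat_map p q) = max (degree p) (degree q)"
  unfolding rat_degree_def
proof (rule the_equality)
  show "\<exists>p' q'. coprime p' q' \<and> rat_map p q = rat_map p' q' \<and>
      max (degree p) (degree q) = max (degree p') (degree q')"
    using assms by blast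
next
  fix n
  assume "\<exists>p' q'. coprime p' q' \<and> rat_map p q = rat_map p' q' \<and>
      n = max (degree p') (degree q')"
  then obtain p' q' where *: "coprime p' q'" "rat_map p q = rat_map p' q'"
    "n = max (degree p') (degree q')"
    by blast
  have eq: "p * q' = p' * q"
    using rat_map_eq_imp_cross_eq[OF *(2)] .
  have "degree p = degree p'"
    using coprime_cross_eq_imp_degree_eq[OF assms *(1) eq] .
  moreover have "degree q = degree q'"
    using coprime_cross_eq_imp_degree_eq[of q p q' p'] assms *(1) eq
    by (simp add: coprime_commute mult.commute)
  ultimately show "n = max (degree p) (degree q)"
    using *(3) by simp
qed

section \<open>Critical points and critical values\<close>

text \<open>A holomorphic coordinate near \<open>a\<close> (its value outside the chart domain is irrelevant),
  and a local parametrization near \<open>a\<close> sending \<open>0\<close> to \<open>a\<close>.\<close>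

definition sphere_chart :: "sphere \<Rightarrow> sphere \<Rightarrow> complex" where
  "sphere_chart a x =
     (case a of
        Some w \<Rightarrow> (case x of Some z \<Rightarrow> z | None \<Rightarrow> 0)
      | None \<Rightarrow> (case x of Some z \<Rightarrow> inverse z | None \<Rightarrow> 0))"

definition sphere_param :: "sphere \<Rightarrow> complex \<Rightarrow> sphere" where
  "sphere_param a t =
     (case a of
        Some w \<Rightarrow> Some (w + t)
      | None \<Rightarrow> if t = 0 then None else Some (inverse t))"

definition critical_points :: "(sphere \<Rightarrow> sphere) \<Rightarrow> sphere set" where
  "critical_points f =
     {a. ((\<lambda>t. sphere_chart (f a) (f (sphere_param a t))) has_field_derivative 0) (at 0)}"

definition critical_values :: "(sphere \<Rightarrow> sphere) \<Rightarrow> sphere set" where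
  "critical_values f = f ` critical_points f"

definition bicritical :: "(sphere \<Rightarrow> sphere) \<Rightarrow> bool" where
  "bicritical f \<longleftrightarrow> rational_map f \<and> card (critical_points f) = 2"

definition power_map :: "(sphere \<Rightarrow> sphere) \<Rightarrow> bool" where
  "power_map f \<longleftrightarrow> bicritical f \<and> critical_points f = critical_values f"

section \<open>Deck groups\<close>

definition moebius :: "(sphere \<Rightarrow> sphere) \<Rightarrow> bool" where
  "moebius \<mu> \<longleftrightarrow> (\<exists>a b c d. a * d - b * c \<noteq> 0 \<and> \<mu> = rat_map [:b, a:] [:d, c:])"

lemma rat_map_moebius:
  assumes "a * d - b * c \<noteq> 0"
  shows "rat_map [:b, a:] [:d, c:] x =
     (case x of
        Some z \<Rightarrow> if c * z + d = 0 then None else Some ((a * z + b) / (c * z + d))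
      | None \<Rightarrow> if c = 0 then None else Some (a / c))"
  using assms
  by (cases "c = 0"; cases "a = 0"; cases x)
    (auto simp: rat_map_def Let_def algebra_simps split: option.splits)

definition Deck :: "(sphere \<Rightarrow> sphere) \<Rightarrow> (sphere \<Rightarrow> sphere) monoid" where
  "Deck F = \<lparr>carrier = {\<mu>. moebius \<mu> \<and> F \<circ> \<mu> = F}, mult = (\<circ>), one = id\<rparr>"

section \<open>Dihedral groups\<close>

text \<open>Groups given by generators and relators. A letter \<open>(x, True)\<close> stands for the generator \<open>x\<close>
  and \<open>(x, False)\<close> for its inverse; the group consists of the words modulo the least congruence
  which cancels adjacent inverse letters and makes every relator trivial.\<close>

inductive pres_eq :: "('a \<times> bool) list set \<Rightarrow> ('a \<times> bool) list \<Rightarrow> ('a \<times> bool) list \<Rightarrow> bool"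
  for rels where
  refl: "pres_eq rels u u"
| sym: "pres_eq rels u v \<Longrightarrow> pres_eq rels v u"
| trans: "pres_eq rels u v \<Longrightarrow> pres_eq rels v w \<Longrightarrow> pres_eq rels u w"
| cancel: "pres_eq rels (u @ [(x, b), (x, \<not> b)] @ v) (u @ v)"
| relator: "r \<in> rels \<Longrightarrow> pres_eq rels (u @ r @ v) (u @ v)"

definition pres_class :: "('a \<times> bool) list set \<Rightarrow> ('a \<times> bool) list \<Rightarrow> ('a \<times> bool) list set" where
  "pres_class rels u = {v. pres_eq rels u v}"

definition presented_group :: "('a \<times> bool) list set \<Rightarrow> ('a \<times> bool) list set monoid" where
  "presented_group rels =
     \<lparr>carrier = range (pres_class rels),
      mult = (\<lambda>A B. \<Union>u\<in>A. \<Union>v\<in>B. pres_class rels (u @ v)),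
      one = pres_class rels []\<rparr>"

lemma pres_class_eq_iff: "pres_class rels u = pres_class rels v \<longleftrightarrow> pres_eq rels u v"
  unfolding pres_class_def by (auto intro: pres_eq.intros)

lemma pres_eq_context: "pres_eq rels u v \<Longrightarrow> pres_eq rels (a @ u @ b) (a @ v @ b)"
proof (induction rule: pres_eq.induct)
  case (cancel u x b' v)
  show ?case
    using pres_eq.cancel[of rels "a @ u" x b' "v @ b"] by simp
next
  case (relator r u v)
  then show ?case
    using pres_eq.relator[of r rels "a @ u" "v @ b"] by simp
qed (auto intro: pres_eq.intros)

lemma pres_eq_append:
  "pres_eq rels u u' \<Longrightarrow> pres_eq rels v v' \<Longrightarrow> pres_eq rels (u @ v) (u' @ v')"
  using pres_eq_context[of rels u u' "[]" v] pres_eq_context[of rels v v' u' "[]"]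
  by (auto intro: pres_eq.trans)

lemma carrier_presented_group: "carrier (presented_group rels) = range (pres_class rels)"
  by (simp add: presented_group_def)

lemma one_presented_group: "\<one>\<^bsub>presented_group rels\<^esub> = pres_class rels []"
  by (simp add: presented_group_def)

lemma mult_presented_group:
  "pres_class rels u \<otimes>\<^bsub>presented_group rels\<^esub> pres_class rels v = pres_class rels (u @ v)"
proof -
  have "pres_class rels (u' @ v') = pres_class rels (u @ v)"
    if "u' \<in> pres_class rels u" "v' \<in> pres_class rels v" for u' v'
    using that
    by (auto simp: pres_class_eq_iff)
      (auto simp: pres_class_def intro: pres_eq_append pres_eq.sym)
  moreover have "u \<in> pres_class rels u" "v \<in> pres_class rels v"
    by (auto simp: pres_class_def intro: pres_eq.refl)
  ultimately have "(\<Union>u'\<in>pres_class rels u. \<Union>v'\<in>pres_class rels v. pres_class rels (u' @ v')) =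
      pres_class rels (u @ v)"
    by blast
  then show ?thesis
    by (simp add: presented_group_def)
qed

lemma pres_eq_inverse: "pres_eq rels (rev (map (\<lambda>(x, b). (x, \<not> b)) u) @ u) []"
proof (induction u)
  case (Cons p u)
  obtain x b where "p = (x, b)"
    by (cases p)
  then show ?case
    using pres_eq.cancel[of rels "rev (map (\<lambda>(x, b). (x, \<not> b)) u)" x "\<not> b" u] Cons
    by (auto intro: pres_eq.trans)
qed (auto intro: pres_eq.refl)

lemma group_presented_group: "group (presented_group rels)"
proof (rule groupI)
  fix x
  assume "x \<in> carrier (presented_group rels)"
  then obtain u where "x = pres_class rels u"
    by (auto simp: carrier_presented_group)
  moreover have "pres_class rels (rev (map (\<lambda>(x, b). (x, \<not> b)) u) @ u) = pres_class rels []"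
    unfolding pres_class_eq_iff by (rule pres_eq_inverse)
  ultimately have "pres_class rels (rev (map (\<lambda>(x, b). (x, \<not> b)) u))
      \<otimes>\<^bsub>presented_group rels\<^esub> x = \<one>\<^bsub>presented_group rels\<^esub>"
    by (simp only: mult_presented_group one_presented_group)
  then show "\<exists>y\<in>carrier (presented_group rels).
      y \<otimes>\<^bsub>presented_group rels\<^esub> x = \<one>\<^bsub>presented_group rels\<^esub>"
    unfolding carrier_presented_group by blast
next
  fix x y z
  assume "x \<in> carrier (presented_group rels)" "y \<in> carrier (presented_group rels)"
    "z \<in> carrier (presented_group rels)"
  then obtain u v w where xyz: "x = pres_class rels u" "y = pres_class rels v"
    "z = pres_class rels w"
    unfolding carrier_presented_group by blast
  show "x \<otimes>\<^bsub>presented_group rels\<^esub> y \<otimes>\<^bsub>presented_group rels\<^esub> z =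
      x \<otimes>\<^bsub>presented_group rels\<^esub> (y \<otimes>\<^bsub>presented_group rels\<^esub> z)"
    unfolding xyz by (simp only: mult_presented_group append_assoc)
next
  fix x y
  assume "x \<in> carrier (presented_group rels)" "y \<in> carrier (presented_group rels)"
  then obtain u v where xy: "x = pres_class rels u" "y = pres_class rels v"
    unfolding carrier_presented_group by blast
  show "x \<otimes>\<^bsub>presented_group rels\<^esub> y \<in> carrier (presented_group rels)"
    unfolding xy mult_presented_group carrier_presented_group by (rule rangeI)
next
  fix x
  assume "x \<in> carrier (presented_group rels)"
  then obtain u where x: "x = pres_class rels u"
    unfolding carrier_presented_group by blast
  show "\<one>\<^bsub>presented_group rels\<^esub> \<otimes>\<^bsub>presented_group rels\<^esub> x = x"
    unfolding x one_presented_group by (simp only: mult_presented_group append_Nil)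
next
  show "\<one>\<^bsub>presented_group rels\<^esub> \<in> carrier (presented_group rels)"
    unfolding one_presented_group carrier_presented_group by (rule rangeI)
qed

datatype dihedral_gen = Rot | Flip

text \<open>The dihedral group of order \<open>2 * n\<close> (for \<open>n \<ge> 2\<close>), written \<open>D\<^sub>2\<^sub>n\<close>; mind the index.\<close>

definition dihedral_group :: "nat \<Rightarrow> (dihedral_gen \<times> bool) list set monoid" where
  "dihedral_group n =
     presented_group
       {replicate n (Rot, True),
        [(Flip, True), (Flip, True)],
        [(Rot, True), (Flip, True), (Rot, True), (Flip, True)]}"

end

theory Submission
  imports Defs "HOL-Computational_Algebra.Fundamental_Theorem_Algebra"
begin

text \<open>The Wronskian \<open>p' q - p q'\<close> has degree at most \<open>2 d - 2\<close>, so two critical points leave room only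
  for total ramification at both, whence \<open>f\<close> is conjugate to \<open>g = M \<circ> z\<^sup>d\<close> with \<open>M\<close> a Moebius map
  and critical points \<open>0\<close> and \<open>\<infinity>\<close>. Let \<open>G k\<close> be the deck group of \<open>g\<^sup>k\<close>. If \<open>\<mu> \<in> G (k + 1)\<close>, then
  \<open>g\<^sup>k \<circ> \<mu> = \<rho> g\<^sup>k\<close> for some \<open>d\<close>-th root of unity \<open>\<rho>\<close>; hence \<open>G k\<close> is normal in \<open>G (k + 1)\<close>. If \<open>g\<close> is
  not a power map, this yields by induction that every \<open>G k\<close> preserves \<open>{0, \<infinity>}\<close>, i.e. consists of
  rotations \<open>a z\<close> and flips \<open>a / z\<close>: conjugation by \<open>\<mu>\<close> maps some rotation of \<open>G k\<close> to a rotation,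
  unless \<open>G k\<close> is a Klein four-group, which needs a look at critical orbits. Finally, a rotation by
  \<open>a\<close> in \<open>G (k + 1)\<close> descends to the map \<open>M \<circ> (a\<^sup>d z) \<circ> M\<^sup>-\<^sup>1\<close> in \<open>G k\<close> with fixed points \<open>M 0\<close> and
  \<open>M \<infinity>\<close>, which must be the identity or a flip, and therefore \<open>a\<^sup>2\<^sup>d = 1\<close>.\<close>

section \<open>Rational maps and Moebius transformations\<close>

lemma sphere_cases:
  obtains "x = None" | "x = Some (0::complex)" | z where "x = Some z" "z \<noteq> 0"
  by (cases x) auto

lemma rat_map_smult:
  assumes "c \<noteq> 0"
  shows "rat_map (smult c p) (smult c q) = rat_map p q"
  using assms by (auto simp: rat_map_def Let_def fun_eq_iff split: option.splits)

lemma dvd_dvd_imp_smult: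
  fixes p q :: "'a::field poly"
  assumes "p dvd q" "q dvd p"
  obtains a where "a \<noteq> 0" "p = smult a q"
proof (cases "q = 0")
  case True
  then show ?thesis
    using assms that[of 1] by simp
next
  case False
  obtain k where k: "p = q * k"
    using assms(2) by blast
  moreover have "degree p = degree q" "p \<noteq> 0"
    using assms False by (auto intro!: le_antisym dvd_imp_degree_le)
  ultimately have "degree k = 0" "k \<noteq> 0"
    using False by (auto simp: degree_mult_eq)
  then obtain a where "k = [:a:]" "a \<noteq> 0"
    by (metis degree_eq_zeroE pCons_0_0)
  then show ?thesis
    using k that[of a] by simp
qed

text \<open>Coprimality makes \<open>p\<close>, \<open>p'\<close> and \<open>q\<close>,
  \<open>q'\<close> associated, and the cross equation equates the two scalars. They can differ only
  if a polynomial vanishes, and then the map is constant.\<close>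

lemma rat_map_cong_cross:
  assumes "coprime p q" "coprime p' q'" "p * q' = p' * q"
  shows "rat_map p q = rat_map p' q'"
proof -
  have "p dvd p' * q" "p' dvd p * q'" "q dvd p * q'" "q' dvd p' * q"
    using assms(3) by (metis dvd_triv_left dvd_triv_right)+
  then have "p dvd p'" "p' dvd p" "q dvd q'" "q' dvd q"
    using assms(1,2)
    by (simp_all add: coprime_dvd_mult_left_iff coprime_dvd_mult_right_iff coprime_commute)
  then obtain a b where a: "a \<noteq> 0" and b: "b \<noteq> 0" and pq: "p = smult a p'" "q = smult b q'"
    by (meson dvd_dvd_imp_smult)
  have "smult (a - b) (p' * q') = 0"
    using assms(3) unfolding pq by (simp add: smult_diff_left)
  then consider "a = b" | "p' = 0" | "q' = 0"
    by auto
  then show ?thesis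
  proof cases
    case 1
    then show ?thesis
      using pq a rat_map_smult by simp
  next
    case 2
    then have "q' \<noteq> 0"
      using assms(2) by auto
    with 2 show ?thesis
      using pq b by (auto simp: rat_map_def Let_def fun_eq_iff split: option.splits)
  next
    case 3
    then have "p' \<noteq> 0"
      using assms(2) by auto
    with 3 show ?thesis
      using pq a by (auto simp: rat_map_def Let_def fun_eq_iff split: option.splits)
  qed
qed

text \<open>Identity theorem: every finite point of agreement, a common pole included, is a root of
  \<open>p * q' - p' * q\<close>.\<close>

lemma rational_map_eqI:
  assumes "rational_map g" "rational_map h" "infinite {x. g x = h x}"
  shows "g = h"
proof -
  obtain p q p' q' where g: "coprime p q" "g = rat_map p q" and h: "coprime p' q'" "h = rat_map p' q'"
    using assms unfolding rational_map_def by blast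
  have "Some ` (Some -` {x. g x = h x}) \<union> {None} \<supseteq> {x. g x = h x}"
  proof
    fix x assume "x \<in> {x. g x = h x}"
    then show "x \<in> Some ` (Some -` {x. g x = h x}) \<union> {None}"
      by (cases x) auto
  qed
  then have inf: "infinite (Some -` {x. g x = h x})"
    using assms(3) by (meson finite.emptyI finite_UnI finite_imageI finite_insert finite_subset)
  have "p * q' = p' * q"
  proof (rule ccontr)
    assume "p * q' \<noteq> p' * q"
    then have "finite {z. poly (p * q' - p' * q) z = 0}"
      by (intro poly_roots_finite) simp
    moreover have "Some -` {x. g x = h x} \<subseteq> {z. poly (p * q' - p' * q) z = 0}"
      unfolding g h by (auto simp: rat_map_def field_simps split: if_splits)
    ultimately show False
      using inf finite_subset by blast
  qed
  then show ?thesis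
    unfolding g(2) h(2) by (rule rat_map_cong_cross[OF g(1) h(1)])
qed

text \<open>The Moebius action in homogeneous coordinates [u : v], which treats infinity like any
  other point.\<close>

lemma moebius_quotient:
  assumes "a * d - b * c \<noteq> 0" "u \<noteq> 0 \<or> v \<noteq> 0"
  shows "rat_map [:b, a:] [:d, c:] (if v = 0 then None else Some (u / v)) =
    (if c * u + d * v = 0 then None else Some ((a * u + b * v) / (c * u + d * v)))"
proof (cases "v = 0")
  case True
  then show ?thesis
    using assms(2) by (simp add: rat_map_moebius[OF assms(1)])
next
  case False
  have e: "c * (u / v) + d = (c * u + d * v) / v" "a * (u / v) + b = (a * u + b * v) / v"
    using False by (simp_all add: add_divide_distrib)
  have "(if y / v = 0 then None else Some (x / v / (y / v))) = (if y = 0 then None else Some (x / y))"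
    for x y :: complex
    using False by simp
  then show ?thesis
    using False unfolding rat_map_moebius[OF assms(1)] by (simp only: option.case if_False e)
qed

lemma moebius_comp_rat_map:
  assumes "a * d - b * c \<noteq> 0" "coprime p q"
  shows "coprime (smult a p + smult b q) (smult c p + smult d q)"
    and "rat_map [:b, a:] [:d, c:] \<circ> rat_map p q =
      rat_map (smult a p + smult b q) (smult c p + smult d q)"
proof -
  \<comment> \<open>Inverting the matrix up to its determinant recovers \<open>p\<close> and
    \<open>q\<close> from the combinations, so a common divisor of these divides both.\<close>
  let ?D = "a * d - b * c"
  have id1: "smult ?D p = smult d (smult a p + smult b q) - smult b (smult c p + smult d q)"
    by (simp add: algebra_simps smult_diff_left smult_add_right)
  have id2: "smult ?D q = smult a (smult c p + smult d q) - smult c (smult a p + smult b q)"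
    by (simp add: algebra_simps smult_diff_left smult_add_right)
  show "coprime (smult a p + smult b q) (smult c p + smult d q)"
  proof (rule coprimeI)
    fix r assume "r dvd smult a p + smult b q" "r dvd smult c p + smult d q"
    then have "r dvd smult ?D p" "r dvd smult ?D q"
      unfolding id1 id2 by (meson dvd_diff dvd_smult)+
    then have "r dvd p" "r dvd q"
      using assms(1) by (simp_all add: dvd_smult_iff)
    then show "is_unit r"
      using assms(2) by (meson coprime_common_divisor)
  qed
  define m where "m = max (degree p) (degree q)"
  have nz: "coeff p m \<noteq> 0 \<or> coeff q m \<noteq> 0"
    using assms(2) unfolding m_def by (cases "p = 0"; cases "q = 0") (auto simp: max_def)
  \<comment> \<open>The larger degree stays \<open>m\<close>, so both sides read their value at
    infinity from the coefficients of index \<open>m\<close>.\<close>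
  let ?m = "max (degree (smult a p + smult b q)) (degree (smult c p + smult d q))"
  have le: "?m \<le> m"
    unfolding m_def by (auto intro!: degree_add_le order.trans[OF degree_smult_le])
  have "coeff (smult a p + smult b q) m \<noteq> 0 \<or> coeff (smult c p + smult d q) m \<noteq> 0"
  proof (rule ccontr)
    assume "\<not> ?thesis"
    then have "a * coeff p m + b * coeff q m = 0" "c * coeff p m + d * coeff q m = 0"
      by auto
    then have "?D * coeff p m = 0" "?D * coeff q m = 0"
      by algebra+
    then show False
      using nz assms(1) by simp
  qed
  then have "?m = m"
    using le by (metis le_antisym le_degree max.cobounded1 max.cobounded2 order.trans)
  have fin: "poly p z \<noteq> 0 \<or> poly q z \<noteq> 0" for z
    using assms(2) coprime_poly_0 by blast
  show "rat_map [:b, a:] [:d, c:] \<circ> rat_map p q =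
      rat_map (smult a p + smult b q) (smult c p + smult d q)"
  proof
    fix x
    show "(rat_map [:b, a:] [:d, c:] \<circ> rat_map p q) x =
      rat_map (smult a p + smult b q) (smult c p + smult d q) x"
    proof (cases x)
      case None
      have "rat_map p q x = (if coeff q m = 0 then None else Some (coeff p m / coeff q m))"
        by (simp add: rat_map_def None m_def Let_def)
      moreover have "rat_map (smult a p + smult b q) (smult c p + smult d q) x =
        (if c * coeff p m + d * coeff q m = 0 then None
         else Some ((a * coeff p m + b * coeff q m) / (c * coeff p m + d * coeff q m)))"
        using \<open>?m = m\<close> by (simp add: rat_map_def None Let_def)
      ultimately show ?thesis
        using moebius_quotient[OF assms(1) nz] by (simp only: o_apply)
    next
      case (Some z)
      have "rat_map p q x = (if poly q z = 0 then None else Some (poly p z / poly q z))"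
        by (simp add: rat_map_def Some)
      moreover have "rat_map (smult a p + smult b q) (smult c p + smult d q) x =
        (if c * poly p z + d * poly q z = 0 then None
         else Some ((a * poly p z + b * poly q z) / (c * poly p z + d * poly q z)))"
        by (simp add: rat_map_def Some)
      ultimately show ?thesis
        using moebius_quotient[OF assms(1) fin[of z]] by (simp only: o_apply)
    qed
  qed
qed

lemma moebiusE:
  assumes "moebius \<mu>"
  obtains a b c d where "a * d - b * c \<noteq> 0" "\<mu> = rat_map [:b, a:] [:d, c:]"
  using assms unfolding moebius_def by blast

lemma moebiusI:
  "a * d - b * c \<noteq> 0 \<Longrightarrow> \<mu> = rat_map [:b, a:] [:d, c:] \<Longrightarrow> moebius \<mu>"
  unfolding moebius_def by blast

text \<open>The pair arises from the coprime pair X, 1 by an invertible matrix.\<close>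

lemma coprime_moebius:
  fixes a b c d :: complex
  assumes "a * d - b * c \<noteq> 0"
  shows "coprime [:b, a:] [:d, c:]"
proof -
  have "coprime [:0, 1::complex:] [:1:]" by (metis coprime_1_right one_pCons)
  from moebius_comp_rat_map(1)[OF assms this] show ?thesis
    by (simp add: add.commute)
qed

lemma rational_map_moebius: "moebius \<mu> \<Longrightarrow> rational_map \<mu>"
  by (metis coprime_moebius moebiusE rational_map_def)

lemma rational_map_moebius_comp:
  assumes "moebius \<mu>" "rational_map h"
  shows "rational_map (\<mu> \<circ> h)"
  using assms moebius_comp_rat_map by (metis moebiusE rational_map_def)

lemma moebius_comp [intro]:
  assumes "moebius \<mu>" "moebius \<nu>"
  shows "moebius (\<mu> \<circ> \<nu>)"
proof -
  obtain a b c d where 1: "a * d - b * c \<noteq> 0" "\<mu> = rat_map [:b, a:] [:d, c:]"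
    using assms(1) by (rule moebiusE)
  obtain a' b' c' d' where 2: "a' * d' - b' * c' \<noteq> 0" "\<nu> = rat_map [:b', a':] [:d', c':]"
    using assms(2) by (rule moebiusE)
  have "(a * a' + b * c') * (c * b' + d * d') - (a * b' + b * d') * (c * a' + d * c') =
      (a * d - b * c) * (a' * d' - b' * c')"
    by algebra
  then show ?thesis
    using 1 2 moebius_comp_rat_map(2)[OF 1(1) coprime_moebius[OF 2(1)]]
    by (intro moebiusI[of "a * a' + b * c'" "c * b' + d * d'" "a * b' + b * d'" "c * a' + d * c'"])
      simp_all
qed

lemma moebius_id [intro, simp]: "moebius id"
  by (rule moebiusI[of 1 1 0 0])
    (auto simp: fun_eq_iff rat_map_def split: option.splits)

lemma moebius_inverse:
  assumes "moebius \<mu>"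
  obtains \<nu> where "moebius \<nu>" "\<nu> \<circ> \<mu> = id" "\<mu> \<circ> \<nu> = id"
proof -
  \<comment> \<open>The adjugate matrix inverts up to the determinant, a scalar that cancels in the
    fraction.\<close>
  have *: "rat_map [:- b, d:] [:a, - c:] \<circ> rat_map [:b, a:] [:d, c:] = id"
    if "a * d - b * c \<noteq> 0" for a b c d
  proof -
    have "d * a - (- b) * (- c) \<noteq> 0"
      using that by (simp add: mult.commute)
    from moebius_comp_rat_map(2)[OF this coprime_moebius[OF that]]
    have "rat_map [:- b, d:] [:a, - c:] \<circ> rat_map [:b, a:] [:d, c:] =
        rat_map (smult (a * d - b * c) [:0, 1:]) (smult (a * d - b * c) [:1:])"
      by (simp add: algebra_simps)
    also have "\<dots> = rat_map [:0, 1:] [:1:]"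
      by (rule rat_map_smult[OF that])
    also have "\<dots> = id"
      by (auto simp: fun_eq_iff rat_map_def split: option.splits)
    finally show ?thesis .
  qed
  obtain a b c d where 1: "a * d - b * c \<noteq> 0" "\<mu> = rat_map [:b, a:] [:d, c:]"
    using assms by (rule moebiusE)
  have 2: "d * a - (- b) * (- c) \<noteq> 0"
    using 1 by (simp add: mult.commute)
  show ?thesis
    using *[OF 1(1)] *[OF 2] 1 2 by (intro that moebiusI[of d a "- b" "- c"]) simp_all
qed

lemma bij_moebius: "moebius \<mu> \<Longrightarrow> bij \<mu>"
  by (metis moebius_inverse o_bij)

section \<open>Rotations, flips and powers\<close>

definition rot :: "complex \<Rightarrow> sphere \<Rightarrow> sphere" where
  "rot a = map_option ((*) a)"

definition flip :: "complex \<Rightarrow> sphere \<Rightarrow> sphere" where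
  "flip a x = (case x of None \<Rightarrow> Some 0 | Some z \<Rightarrow> if z = 0 then None else Some (a / z))"

definition pw :: "nat \<Rightarrow> sphere \<Rightarrow> sphere" where
  "pw n = map_option (\<lambda>z. z ^ n)"

lemma rot_simps [simp]: "rot a None = None" "rot a (Some z) = Some (a * z)"
  by (simp_all add: rot_def)

lemma flip_simps [simp]:
  "flip a None = Some 0" "flip a (Some 0) = None" "z \<noteq> 0 \<Longrightarrow> flip a (Some z) = Some (a / z)"
  by (simp_all add: flip_def)

lemma pw_simps [simp]: "pw n None = None" "pw n (Some z) = Some (z ^ n)"
  by (simp_all add: pw_def)

lemma moebius_rot [intro]: "a \<noteq> 0 \<Longrightarrow> moebius (rot a)"
  by (rule moebiusI[of a 1 0 0])
    (auto simp: fun_eq_iff rat_map_def rot_def split: option.splits)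

lemma moebius_flip [intro]: "a \<noteq> 0 \<Longrightarrow> moebius (flip a)"
  by (rule moebiusI[of 0 0 a 1])
    (auto simp: fun_eq_iff rat_map_def flip_def split: option.splits)

lemma rot_rot: "rot a \<circ> rot b = rot (a * b)"
proof
  show "(rot a \<circ> rot b) x = rot (a * b) x" for x
    by (cases x) simp_all
qed

lemma rot_one [simp]: "rot 1 = id"
proof
  show "rot 1 x = id x" for x
    by (cases x) simp_all
qed

lemma rot_flip: "rot a \<circ> flip b = flip (a * b)"
  by (auto simp: rot_def flip_def fun_eq_iff split: option.splits)

lemma flip_rot: "b \<noteq> 0 \<Longrightarrow> flip a \<circ> rot b = flip (a / b)"
  by (auto simp: rot_def flip_def fun_eq_iff split: option.splits)

lemma flip_flip: "a \<noteq> 0 \<Longrightarrow> b \<noteq> 0 \<Longrightarrow> flip a \<circ> flip b = rot (a / b)"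
  by (auto simp: rot_def flip_def fun_eq_iff split: option.splits)

lemma rot_eq_iff [simp]: "rot a = rot b \<longleftrightarrow> a = b"
  by (metis mult.right_neutral option.inject rot_simps(2))

lemma flip_eq_iff [simp]: "flip a = flip b \<longleftrightarrow> a = b"
  by (metis div_by_1 flip_simps(3) option.inject zero_neq_one)

lemma rot_neq_flip [simp]: "rot a \<noteq> flip b" "flip b \<noteq> rot a"
  by (metis flip_simps(1) option.distinct(1) rot_simps(1))+

lemma rot_eq_id_iff [simp]: "rot a = id \<longleftrightarrow> a = 1"
  by (metis rot_eq_iff rot_one)

lemma flip_neq_id [simp]: "flip b \<noteq> id"
  by (metis rot_neq_flip(2) rot_one)

lemma pw_rot: "pw n \<circ> rot a = rot (a ^ n) \<circ> pw n"
  by (auto simp: fun_eq_iff pw_def rot_def option.map_comp o_def power_mult_distrib)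

lemma pw_flip: "n > 0 \<Longrightarrow> pw n \<circ> flip a = flip (a ^ n) \<circ> pw n"
  by (auto simp: fun_eq_iff pw_def flip_def power_divide split: option.splits)

lemma pw_pw: "pw m \<circ> pw n = pw (m * n)"
proof
  show "(pw m \<circ> pw n) x = pw (m * n) x" for x
    by (cases x) (simp_all add: mult.commute[of m] power_mult)
qed

lemma pw_1 [simp]: "pw (Suc 0) = id"
proof
  show "pw (Suc 0) x = id x" for x
    by (cases x) simp_all
qed

lemma surj_pw: "n > 0 \<Longrightarrow> surj (pw n)"
proof -
  assume "n > 0"
  have "\<exists>x. pw n x = y" for y
  proof (cases y)
    case (Some z)
    obtain w where "w ^ n = z"
      using \<open>n > 0\<close> by (metis exists_complex_root not_gr0)
    then show ?thesis
      using Some by (intro exI[of _ "Some w"]) simp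
  qed (auto intro: exI[of _ None])
  then show ?thesis
    by (metis surjI)
qed

lemma rot_fixed_iff: "a \<noteq> 1 \<Longrightarrow> rot a x = x \<longleftrightarrow> x \<in> {Some 0, None}"
  by (cases x) auto

lemma moebius_rot_or_flip:
  assumes "moebius \<mu>" "\<mu> ` {Some 0, None} = {Some 0, None}"
  shows "(\<exists>a. a \<noteq> 0 \<and> \<mu> = rot a) \<or> (\<exists>a. a \<noteq> 0 \<and> \<mu> = flip a)"
proof -
  obtain a b c d where D: "a * d - b * c \<noteq> 0" and mu: "\<mu> = rat_map [:b, a:] [:d, c:]"
    using assms(1) by (rule moebiusE)
  have \<mu>: "\<mu> x =
      (case x of Some z \<Rightarrow> if c * z + d = 0 then None else Some ((a * z + b) / (c * z + d))
       | None \<Rightarrow> if c = 0 then None else Some (a / c))" for x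
    unfolding mu by (rule rat_map_moebius[OF D])
  have v: "\<mu> None = (if c = 0 then None else Some (a / c))"
    "\<mu> (Some 0) = (if d = 0 then None else Some (b / d))"
    by (simp_all add: \<mu>)
  have "\<mu> None \<noteq> \<mu> (Some 0)"
    using bij_moebius[OF assms(1)] by (metis bij_pointE option.distinct(1))
  then consider "\<mu> None = None" "\<mu> (Some 0) = Some 0" | "\<mu> None = Some 0" "\<mu> (Some 0) = None"
    using assms(2) by (auto simp: doubleton_eq_iff)
  then show ?thesis
  proof cases
    case 1
    then have "c = 0" "b = 0"
      using v D by (auto split: if_splits)
    then have "\<mu> = rot (a / d)" "a / d \<noteq> 0"
      using D by (auto simp: \<mu> fun_eq_iff rot_def split: option.splits)
    then show ?thesis by blast
  next
    case 2
    then have "a = 0" "d = 0"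
      using v D by (auto split: if_splits)
    then have "\<mu> = flip (b / c)" "b / c \<noteq> 0"
      using D by (auto simp: \<mu> fun_eq_iff flip_def split: option.splits)
    then show ?thesis by blast
  qed
qed

lemma pw_comp_rat_map:
  assumes "n > 0"
  shows "pw n \<circ> rat_map p q = rat_map (p ^ n) (q ^ n)"
proof
  fix x
  show "(pw n \<circ> rat_map p q) x = rat_map (p ^ n) (q ^ n) x"
  proof (cases x)
    case None
    \<comment> \<open>The index \<open>m\<close> may exceed \<open>degree r\<close>, in which case
      both sides are 0; numerator and denominator can thus be read at a common index.\<close>
    have cf: "coeff (r ^ n) (n * m) = coeff r m ^ n" if "degree r \<le> m" for r :: "complex poly" and m
    proof (cases "degree r = m")
      case True
      then show ?thesis
        by (metis degree_power_eq coeff_0 lead_coeff_power mult.commute power_0_left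
            assms not_gr0)
    next
      case False
      then have "degree r < m"
        using that by simp
      then have "degree (r ^ n) < n * m"
        using assms degree_power_le[of r n]
        by (metis le_less_trans mult.commute mult_less_cancel1)
      then show ?thesis
        using \<open>degree r < m\<close> assms(1) by (simp add: coeff_eq_0)
    qed
    have m: "max (degree (p ^ n)) (degree (q ^ n)) = n * max (degree p) (degree q)"
      by (cases "p = 0"; cases "q = 0")
        (use assms(1) in \<open>simp_all add: degree_power_eq nat_mult_max_right power_0_left\<close>)
    show ?thesis
      using None assms(1) by (simp add: rat_map_def Let_def m cf power_divide)
  next
    case (Some z)
    then show ?thesis
      using assms(1) by (simp add: rat_map_def power_divide)
  qed
qed

lemma rational_map_pw_comp:
  assumes "n > 0" "rational_map h"
  shows "rational_map (pw n \<circ> h)"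
  using assms pw_comp_rat_map[OF assms(1)] unfolding rational_map_def
  by (metis coprime_power_left_iff coprime_power_right_iff)

lemma pw_eq_imp_rot:
  assumes "n > 0" "pw n x = pw n y"
  shows "\<exists>\<rho>. \<rho> ^ n = 1 \<and> x = rot \<rho> y"
proof (cases x)
  case None
  then show ?thesis
    using assms by (cases y) (auto intro: exI[of _ 1])
next
  case (Some z)
  then obtain w where y: "y = Some w" and e: "z ^ n = w ^ n"
    using assms by (cases y) auto
  show ?thesis
  proof (cases "w = 0")
    case True
    then show ?thesis
      using Some y e assms(1) by (intro exI[of _ 1]) (simp add: power_0_left)
  next
    case False
    then show ?thesis
      using Some y e by (intro exI[of _ "z / w"]) (simp add: power_divide)
  qed
qed

text \<open>Pointwise the two maps differ by a root of unity. One root of unity occurs at infinitely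
  many points, and there the identity theorem for rational maps applies.\<close>

lemma pw_comp_eq_imp_rot:
  assumes "n > 0" "pw n \<circ> h1 = pw n \<circ> h2" "rational_map h1" "rational_map h2"
  shows "\<exists>\<rho>. \<rho> ^ n = 1 \<and> h1 = rot \<rho> \<circ> h2"
proof -
  have "\<exists>\<rho>\<in>{\<rho>. \<rho> ^ n = 1}. h1 x = rot \<rho> (h2 x)" for x
    using pw_eq_imp_rot[OF assms(1)] assms(2) by (auto simp: fun_eq_iff)
  then have "(\<Union>\<rho>\<in>{\<rho>. \<rho> ^ n = 1}. {x. h1 x = rot \<rho> (h2 x)}) = UNIV"
    by auto
  moreover have "infinite (UNIV :: sphere set)"
    by (simp add: infinite_UNIV_char_0 finite_option_UNIV)
  ultimately have "infinite (\<Union>\<rho>\<in>{\<rho>::complex. \<rho> ^ n = 1}. {x. h1 x = rot \<rho> (h2 x)})"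
    by simp
  moreover have "finite {\<rho>::complex. \<rho> ^ n = 1}"
    using assms(1) by (simp add: finite_roots_unity Suc_leI)
  ultimately obtain \<rho> where \<rho>: "\<rho> ^ n = 1" "infinite {x. h1 x = (rot \<rho> \<circ> h2) x}"
    by auto
  then have "\<rho> \<noteq> 0"
    using assms(1) by (metis power_0_left zero_neq_one not_gr0)
  then have "h1 = rot \<rho> \<circ> h2"
    using \<rho>(2) assms by (intro rational_map_eqI rational_map_moebius_comp) auto
  with \<rho>(1) show ?thesis by blast
qed

section \<open>Bicritical maps as compositions with a power\<close>

definition wronskian :: "'a::idom poly \<Rightarrow> 'a poly \<Rightarrow> 'a poly" where
  "wronskian p q = pderiv p * q - p * pderiv q"

text \<open>The Wronskian is bilinear and alternating, so a linear change of the pair multiplies it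
  by the determinant.\<close>

lemma wronskian_combination:
  "wronskian (smult a p + smult b q) (smult c p + smult d q) = smult (a * d - b * c) (wronskian p q)"
  by (simp add: wronskian_def pderiv_add pderiv_smult ring_distribs smult_add_right
      smult_diff_right smult_diff_left mult.commute[of "pderiv p"]
      mult.commute[of "pderiv q"] mult.commute[of c] mult.commute[of d])

text \<open>If r = (X - x)^(e + 1) s with s(x) nonzero, the Wronskian is (X - x)^e times a
  polynomial with value (e + 1) s(x) q(x) at \<open>x\<close>, nonzero in characteristic 0.\<close>

lemma order_wronskian:
  fixes r q :: "'a::field_char_0 poly"
  assumes "r \<noteq> 0" "poly r x = 0" "poly q x \<noteq> 0"
  shows "wronskian r q \<noteq> 0" "Polynomial.order x (wronskian r q) = Polynomial.order x r - 1"
proof -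
  obtain s where s: "r = [:- x, 1:] ^ Polynomial.order x r * s" "\<not> [:- x, 1:] dvd s"
    using order_decomp[OF assms(1)] by blast
  obtain e where e: "Polynomial.order x r = Suc e"
    using assms(1,2) by (metis order_root not0_implies_Suc)
  with s(1) have r: "r = [:- x, 1:] ^ Suc e * s"
    by metis
  let ?l = "[:- x, 1:]"
  let ?t = "smult (of_nat (Suc e)) (s * q) + ?l * (pderiv s * q - s * pderiv q)"
  have W: "wronskian r q = ?l ^ e * ?t"
    unfolding wronskian_def r pderiv_mult pderiv_power_Suc
    by (simp add: pderiv_pCons algebra_simps)
  have nz: "poly ?t x \<noteq> 0"
    using s(2) assms(3) by (simp add: poly_eq_0_iff_dvd del: of_nat_Suc)
  then have "?t \<noteq> 0"
    by (metis poly_0)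
  then show W0: "wronskian r q \<noteq> 0"
    unfolding W by (metis mult_eq_0_iff pCons_eq_0_iff power_eq_0_iff zero_neq_one)
  have "Polynomial.order x (wronskian r q) = Polynomial.order x (?l ^ e) + Polynomial.order x ?t"
    using W0 unfolding W by (rule order_mult)
  also have "Polynomial.order x (?l ^ e) = e"
    by (simp add: order_power_n_n)
  also have "Polynomial.order x ?t = 0"
    using nz by (rule order_0I)
  finally show "Polynomial.order x (wronskian r q) = Polynomial.order x r - 1"
    by (simp add: e)
qed

text \<open>The coefficient of index \<open>?m\<close> is \<open>degree r - degree q\<close> times
  both leading coefficients, which is nonzero because the degrees differ and the characteristic is
  0.\<close>

lemma degree_wronskian:
  fixes r q :: "'a::field_char_0 poly"
  assumes "r \<noteq> 0" "degree r < degree q"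
  shows "degree (wronskian r q) = degree r + degree q - 1"
proof -
  let ?m = "degree r + degree q - 1"
  have c1: "coeff (pderiv r * q) ?m = of_nat (degree r) * (lead_coeff r * lead_coeff q)"
  proof (cases "degree r")
    case 0
    then show ?thesis
      by (metis mult_zero_left pderiv_eq_0_iff coeff_0 of_nat_0)
  next
    case (Suc k)
    then have "?m = degree (pderiv r) + degree q"
      by (simp add: degree_pderiv)
    then have "coeff (pderiv r * q) ?m = lead_coeff (pderiv r) * lead_coeff q"
      by (simp only: coeff_mult_degree_sum)
    then show ?thesis
      by (simp add: degree_pderiv coeff_pderiv Suc)
  qed
  have "?m = degree r + degree (pderiv q)"
    using assms(2) by (simp add: degree_pderiv)
  then have "coeff (r * pderiv q) ?m = lead_coeff r * lead_coeff (pderiv q)"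
    by (simp only: coeff_mult_degree_sum)
  then have c2: "coeff (r * pderiv q) ?m = of_nat (degree q) * (lead_coeff r * lead_coeff q)"
    using assms(2) by (simp add: degree_pderiv coeff_pderiv)
  have "coeff (wronskian r q) ?m = (of_nat (degree r) - of_nat (degree q)) * (lead_coeff r * lead_coeff q)"
    unfolding wronskian_def coeff_diff c1 c2 by (simp add: algebra_simps)
  moreover have "(of_nat (degree r) - of_nat (degree q)) * (lead_coeff r * lead_coeff q) \<noteq> 0"
    using assms by auto
  ultimately have "?m \<le> degree (wronskian r q)"
    by (intro le_degree) simp
  moreover have "degree (pderiv r * q) \<le> ?m"
  proof (cases "degree r")
    case 0
    then show ?thesis
      by (metis mult_zero_left pderiv_eq_0_iff degree_0 le0)
  next
    case Suc
    then show ?thesis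
      using degree_mult_le[of "pderiv r" q] by (simp add: degree_pderiv)
  qed
  moreover have "degree (r * pderiv q) \<le> ?m"
    using degree_mult_le[of r "pderiv q"] assms(2) by (simp add: degree_pderiv)
  ultimately show ?thesis
    unfolding wronskian_def by (intro le_antisym degree_diff_le)
qed

section \<open>Critical points in terms of the Wronskian\<close>

text \<open>At a pole the chart at infinity reads the reciprocal \<open>q / p\<close>, so both maps
  have the same expression in coordinates. This reduces poles to zeros.\<close>

lemma critical_points_swap:
  assumes "coprime p q" "rat_map p q a = None"
  shows "rat_map q p a = Some 0"
    and "a \<in> critical_points (rat_map p q) \<longleftrightarrow> a \<in> critical_points (rat_map q p)"
proof -
  have fin: "poly p z \<noteq> 0 \<or> poly q z \<noteq> 0" for z
    using assms(1) coprime_poly_0 by blast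
  define m where "m = max (degree p) (degree q)"
  have inf: "coeff p m \<noteq> 0 \<or> coeff q m \<noteq> 0"
    using assms(1) unfolding m_def by (cases "p = 0"; cases "q = 0") (auto simp: max_def)
  have m: "m = max (degree q) (degree p)"
    by (simp add: m_def max.commute)
  show 0: "rat_map q p a = Some 0"
  proof (cases a)
    case None
    then show ?thesis
      using assms(2) inf by (simp add: rat_map_def Let_def flip: m m_def split: if_splits)
  next
    case (Some z)
    then show ?thesis
      using assms(2) fin[of z] by (simp add: rat_map_def split: if_splits)
  qed
  have "sphere_chart None (rat_map p q x) = sphere_chart (Some 0) (rat_map q p x)" for x
  proof (cases x)
    case None
    then show ?thesis
      by (simp add: rat_map_def Let_def sphere_chart_def flip: m m_def)
  next
    case (Some z)
    then show ?thesis
      by (simp add: rat_map_def sphere_chart_def)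
  qed
  then show "a \<in> critical_points (rat_map p q) \<longleftrightarrow> a \<in> critical_points (rat_map q p)"
    unfolding critical_points_def by (simp add: assms(2) 0)
qed

text \<open>Away from poles the derivative is the Wronskian divided by the square of
  \<open>q\<close>. At a pole, exchanging \<open>p\<close> and \<open>q\<close> only changes the
  sign of the Wronskian.\<close>

lemma critical_point_finite_iff:
  assumes "coprime p q"
  shows "Some z \<in> critical_points (rat_map p q) \<longleftrightarrow> poly (wronskian p q) z = 0"
proof -
  have main: "Some z \<in> critical_points (rat_map p q) \<longleftrightarrow> poly (wronskian p q) z = 0"
    if "poly q z \<noteq> 0" for p q
  proof -
    have D: "((\<lambda>t. poly p (z + t) / poly q (z + t)) has_field_derivative
        poly (wronskian p q) z / (poly q z * poly q z)) (at 0)"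
      using that by (auto intro!: derivative_eq_intros simp: wronskian_def)
    have "((\<lambda>t. poly q (z + t)) \<longlongrightarrow> poly q (z + 0)) (nhds 0)"
      by (intro tendsto_intros filterlim_ident)
    then have "eventually (\<lambda>t. poly q (z + t) \<noteq> 0) (nhds 0)"
      using that by (intro tendsto_imp_eventually_ne) auto
    then have ev: "eventually (\<lambda>t. poly p (z + t) / poly q (z + t) =
        sphere_chart (rat_map p q (Some z)) (rat_map p q (sphere_param (Some z) t))) (nhds 0)"
      by eventually_elim (use that in \<open>simp add: rat_map_def sphere_chart_def sphere_param_def\<close>)
    have D': "((\<lambda>t. sphere_chart (rat_map p q (Some z)) (rat_map p q (sphere_param (Some z) t)))
        has_field_derivative poly (wronskian p q) z / (poly q z * poly q z)) (at 0)"
      using D unfolding DERIV_cong_ev[OF HOL.refl ev HOL.refl] .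
    show ?thesis
      unfolding critical_points_def mem_Collect_eq
    proof
      assume "((\<lambda>t. sphere_chart (rat_map p q (Some z)) (rat_map p q (sphere_param (Some z) t)))
        has_field_derivative 0) (at 0)"
      from DERIV_unique[OF D' this] show "poly (wronskian p q) z = 0"
        using that by simp
    qed (use D' in simp)
  qed
  show ?thesis
  proof (cases "poly q z = 0")
    case True
    then have nz: "poly p z \<noteq> 0"
      using assms coprime_poly_0 by blast
    have minus: "wronskian q p = - wronskian p q"
      by (simp add: wronskian_def mult.commute)
    have "rat_map p q (Some z) = None"
      using True by (simp add: rat_map_def)
    then have "Some z \<in> critical_points (rat_map p q) \<longleftrightarrow> Some z \<in> critical_points (rat_map q p)"
      by (rule critical_points_swap(2)[OF assms])
    also have "\<dots> \<longleftrightarrow> poly (wronskian q p) z = 0"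
      using nz by (rule main)
    also have "\<dots> \<longleftrightarrow> poly (wronskian p q) z = 0"
      unfolding minus by simp
    finally show ?thesis .
  qed (rule main)
qed

text \<open>With z = 1/t the difference quotient at 0 is z r(z) / s(z). It tends to 0 since
  \<open>r\<close> is zero or of degree at most \<open>n - 2\<close>.\<close>

lemma DERIV_poly_quotient_at_infinity:
  fixes r s :: "complex poly"
  assumes "degree s = n" "n > 0" "degree r < n" "coeff r (n - 1) = 0"
  shows "((\<lambda>t. if t = 0 then 0 else poly r (inverse t) / poly s (inverse t))
    has_field_derivative 0) (at 0)"
proof -
  have "((\<lambda>t. poly [:0,1:] (inverse t) * poly r (inverse t) / poly s (inverse t)) \<longlongrightarrow> 0) (at (0::complex))"
  proof -
    have "s \<noteq> 0" using assms by auto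
    have "degree r < n - 1 \<or> r = 0"
      using assms by (cases "degree r = n - 1") (auto, metis leading_coeff_0_iff)
    then have "degree ([:0,1:] * r) < degree s"
      using assms by (auto simp: degree_mult_eq)
    then have "((\<lambda>x. poly ([:0,1:] * r) x / poly s x) \<longlongrightarrow> 0) at_infinity"
      by (rule poly_divide_tendsto_0_at_infinity)
    then show ?thesis
      unfolding at_to_infinity filterlim_filtermap by simp
  qed
  then show ?thesis
    unfolding has_field_derivative_iff
    by (rule Lim_transform_eventually)
      (auto simp: eventually_at_filter field_simps)
qed

text \<open>Subtracting the value \<open>w\<close> at infinity leaves \<open>r / q\<close>. The
  choice of \<open>w\<close> kills the coefficient of index \<open>m\<close> in \<open>r\<close>,
  the last hypothesis the next one.\<close>

lemma critical_point_infinity_finite_value: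
  assumes "coprime p q" "m = max (degree p) (degree q)" "m > 0" "coeff q m \<noteq> 0"
    and "coeff (smult (coeff q m) p - smult (coeff p m) q) (m - 1) = 0"
  shows "None \<in> critical_points (rat_map p q)"
proof -
  define w where "w = coeff p m / coeff q m"
  define r where "r = p - smult w q"
  have dq: "degree q = m"
    using assms(2,4) by (metis le_degree le_antisym max.cobounded2)
  have f: "rat_map p q None = Some w"
    using assms(4) by (simp add: rat_map_def Let_def w_def flip: assms(2))
  have "smult (coeff q m) r = smult (coeff q m) p - smult (coeff p m) q"
    using assms(4) by (simp add: r_def w_def smult_diff_right)
  then have r1: "coeff r (m - 1) = 0"
    using assms(4,5) by (metis coeff_smult mult_eq_0_iff)
  have "degree r \<le> m"
    unfolding r_def using assms(2) dq by (intro degree_diff_le) (auto intro: order.trans[OF degree_smult_le])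
  moreover have "coeff r m = 0"
    using assms(4) by (simp add: r_def w_def)
  ultimately have "degree r < m"
    using assms(3) by (metis degree_0 leading_coeff_0_iff le_neq_implies_less)
  from DERIV_poly_quotient_at_infinity[OF dq assms(3) this r1]
  have D: "((\<lambda>t. (if t = 0 then 0 else poly r (inverse t) / poly q (inverse t)) + w)
      has_field_derivative 0) (at 0)"
    by (auto intro!: derivative_eq_intros)
  \<comment> \<open>Beyond the finitely many zeros of \<open>q\<close> the quotient formula is
    valid, hence on a neighbourhood of infinity.\<close>
  have "q \<noteq> 0"
    using assms(4) by auto
  then have "bounded {z. poly q z = 0}"
    by (intro finite_imp_bounded poly_roots_finite)
  then obtain B where "\<And>z. poly q z = 0 \<Longrightarrow> norm z \<le> B"
    unfolding bounded_iff by blast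
  then have "eventually (\<lambda>z. poly q z \<noteq> 0) at_infinity"
    by (intro eventually_at_infinityI[of "B + 1"]) fastforce
  then have "eventually (\<lambda>t. poly q (inverse t) \<noteq> 0) (at 0)"
    by (simp add: at_to_infinity eventually_filtermap)
  then have "eventually (\<lambda>t. t \<noteq> 0 \<longrightarrow> poly q (inverse t) \<noteq> 0) (nhds 0)"
    by (simp add: eventually_at_filter)
  then have ev: "eventually (\<lambda>t. (if t = 0 then 0 else poly r (inverse t) / poly q (inverse t)) + w =
      sphere_chart (rat_map p q None) (rat_map p q (sphere_param None t))) (nhds 0)"
  proof eventually_elim
    case (elim t)
    show ?case
    proof (cases "t = 0")
      case False
      then have "rat_map p q (sphere_param None t) = Some (poly p (inverse t) / poly q (inverse t))"
        using elim by (simp add: rat_map_def sphere_param_def)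
      then show ?thesis
        using False elim by (simp add: f sphere_chart_def r_def diff_divide_distrib)
    qed (simp add: f sphere_chart_def sphere_param_def)
  qed
  then show ?thesis
    unfolding critical_points_def using D
    unfolding DERIV_cong_ev[OF HOL.refl ev HOL.refl] by simp
qed


text \<open>A pole at infinity becomes a zero after exchanging \<open>p\<close> and
  \<open>q\<close>, which only changes the sign of the combination.\<close>

lemma critical_point_infinityI:
  assumes "coprime p q" "m = max (degree p) (degree q)" "m > 0"
    and "coeff (smult (coeff q m) p - smult (coeff p m) q) (m - 1) = 0"
  shows "None \<in> critical_points (rat_map p q)"
proof (cases "coeff q m = 0")
  case False
  then show ?thesis
    using critical_point_infinity_finite_value assms by blast
next
  case True
  then have None: "rat_map p q None = None"
    by (simp add: rat_map_def Let_def flip: assms(2))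
  have "p \<noteq> 0"
  proof
    assume "p = 0"
    then have "degree q = 0"
      using assms(1) by (auto simp: is_unit_poly_iff)
    then show False
      using assms(2,3) \<open>p = 0\<close> by simp
  qed
  then have "coeff p m \<noteq> 0"
    using True assms(2,3) by (metis leading_coeff_0_iff max_def degree_0 not_gr0)
  moreover have "coeff (smult (coeff p m) q - smult (coeff q m) p) (m - 1) = 0"
    using assms(4) by simp
  moreover have "m = max (degree q) (degree p)" "coprime q p"
    using assms(1,2) by (simp_all add: max.commute coprime_commute)
  ultimately have "None \<in> critical_points (rat_map q p)"
    using critical_point_infinity_finite_value assms(3) by blast
  then show ?thesis
    using critical_points_swap(2)[OF assms(1) None] by simp
qed

text \<open>The polynomials whose zeros are the finite points of the fibre through \<open>x\<close>, resp. through
  \<open>\<infinity>\<close>.\<close>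

definition finite_fibre :: "complex poly \<Rightarrow> complex poly \<Rightarrow> complex \<Rightarrow> complex poly" where
  "finite_fibre p q x = smult (poly q x) p + smult (- poly p x) q"

definition infinite_fibre :: "complex poly \<Rightarrow> complex poly \<Rightarrow> complex poly" where
  "infinite_fibre p q =
     (let m = max (degree p) (degree q) in smult (coeff q m) p + smult (- coeff p m) q)"

section \<open>Local degrees\<close>

text \<open>Pairing the fibre polynomial with whichever of \<open>q\<close>, \<open>p\<close> does
  not vanish at \<open>x\<close> changes the Wronskian only by a nonzero factor, and
  \<open>order_wronskian\<close> applies. The order of the fibre polynomial at \<open>x\<close> is
  the local degree there.\<close>

lemma order_wronskian_finite_fibre:
  assumes "coprime p q" "wronskian p q \<noteq> 0"
  shows "finite_fibre p q x \<noteq> 0"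
    and "Polynomial.order x (finite_fibre p q x) = Suc (Polynomial.order x (wronskian p q))"
proof -
  let ?R = "finite_fibre p q x"
  have R0: "poly ?R x = 0"
    by (simp add: finite_fibre_def)
  obtain s k where sk: "poly s x \<noteq> 0" "k \<noteq> 0" "wronskian ?R s = smult k (wronskian p q)"
  proof (cases "poly q x = 0")
    case False
    have "wronskian ?R q = smult (poly q x) (wronskian p q)"
      using wronskian_combination[of "poly q x" p "- poly p x" q 0 1] by (simp add: finite_fibre_def)
    with False show ?thesis
      by (intro that[of q "poly q x"])
  next
    case True
    then have "poly p x \<noteq> 0"
      using assms(1) coprime_poly_0 by blast
    moreover have "wronskian ?R p = smult (poly p x) (wronskian p q)"
      using wronskian_combination[of "poly q x" p "- poly p x" q 1 0] by (simp add: finite_fibre_def)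
    ultimately show ?thesis
      using that by blast
  qed
  have "wronskian ?R s \<noteq> 0"
    using sk assms(2) by simp
  then show ne: "?R \<noteq> 0"
    by (auto simp: wronskian_def)
  have "Polynomial.order x (wronskian p q) = Polynomial.order x ?R - 1"
    using order_wronskian(2)[OF ne R0 sk(1)] sk(2,3) by (simp add: order_smult)
  moreover have "Polynomial.order x ?R \<noteq> 0"
    using R0 ne order_root by blast
  ultimately show "Polynomial.order x ?R = Suc (Polynomial.order x (wronskian p q))"
    by simp
qed

lemma degree_combination_le:
  "degree (smult a p + smult b q) \<le> max (degree p) (degree q)"
  by (auto intro!: degree_add_le order.trans[OF degree_smult_le])

lemma order_wronskian_le:
  fixes p q :: "complex poly"
  assumes "coprime p q" "wronskian p q \<noteq> 0"
  shows "Suc (Polynomial.order x (wronskian p q)) \<le> max (degree p) (degree q)"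
proof -
  have "Suc (Polynomial.order x (wronskian p q)) \<le> degree (finite_fibre p q x)"
    using order_wronskian_finite_fibre[OF assms] order_degree by metis
  also have "\<dots> \<le> max (degree p) (degree q)"
    unfolding finite_fibre_def by (rule degree_combination_le)
  finally show ?thesis .
qed

text \<open>Total ramification: a root of maximal order uses up the whole degree and leaves a
  constant cofactor.\<close>

lemma finite_fibre_eq_power:
  assumes "coprime p q" "wronskian p q \<noteq> 0"
    and "Suc (Polynomial.order x (wronskian p q)) = max (degree p) (degree q)"
  obtains c where "c \<noteq> 0" "finite_fibre p q x = smult c ([:- x, 1:] ^ max (degree p) (degree q))"
proof -
  let ?n = "max (degree p) (degree q)" and ?R = "finite_fibre p q x"
  have ne: "?R \<noteq> 0" and o: "Polynomial.order x ?R = ?n"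
    using order_wronskian_finite_fibre[OF assms(1,2)] assms(3) by simp_all
  obtain s where s: "?R = [:- x, 1:] ^ ?n * s"
    using order_1[of x ?R] unfolding o by blast
  then have "s \<noteq> 0"
    using ne by auto
  then have "degree ?R = ?n + degree s"
    unfolding s by (subst degree_mult_eq) (simp_all add: degree_power_eq)
  moreover have "degree ?R \<le> ?n"
    unfolding finite_fibre_def by (rule degree_combination_le)
  ultimately have "degree s = 0"
    by simp
  then obtain c where "s = [:c:]"
    by (rule degree_eq_zeroE)
  then show ?thesis
    using s \<open>s \<noteq> 0\<close> by (intro that[of c]) auto
qed

text \<open>The analogue at infinity, by \<open>degree_wronskian\<close>. The local degree there is
  \<open>n - degree (infinite_fibre p q)\<close>, and the Wronskian falls short of degree
  \<open>2 * n - 2\<close> by one less than that.\<close>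

lemma infinite_fibre_degree:
  assumes "coprime p q" "wronskian p q \<noteq> 0"
  defines "n \<equiv> max (degree p) (degree q)"
  shows "infinite_fibre p q \<noteq> 0" "degree (infinite_fibre p q) < n"
    "degree (wronskian p q) = degree (infinite_fibre p q) + n - 1"
proof -
  let ?R = "infinite_fibre p q"
  have R: "?R = smult (coeff q n) p + smult (- coeff p n) q"
    by (simp add: infinite_fibre_def n_def Let_def)
  have "n \<noteq> 0"
  proof
    assume "n = 0"
    then have "pderiv p = 0" "pderiv q = 0"
      by (simp_all add: n_def pderiv_eq_0_iff)
    then show False
      using assms(2) by (simp add: wronskian_def)
  qed
  obtain s k where sk: "degree s = n" "k \<noteq> 0" "wronskian ?R s = smult k (wronskian p q)"
  proof (cases "coeff q n = 0")
    case False
    then have "degree q = n"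
      unfolding n_def by (metis le_degree le_antisym max.cobounded2)
    moreover have "wronskian ?R q = smult (coeff q n) (wronskian p q)"
      using wronskian_combination[of "coeff q n" p "- coeff p n" q 0 1] by (simp add: R)
    ultimately show ?thesis
      using False that by blast
  next
    case True
    then have "coeff p n \<noteq> 0"
      using \<open>n \<noteq> 0\<close> unfolding n_def
      by (metis leading_coeff_0_iff max_def degree_0)
    moreover from this have "degree p = n"
      unfolding n_def by (metis le_degree le_antisym max.cobounded1)
    moreover have "wronskian ?R p = smult (coeff p n) (wronskian p q)"
      using wronskian_combination[of "coeff q n" p "- coeff p n" q 1 0] by (simp add: R)
    ultimately show ?thesis
      using that by blast
  qed
  have "wronskian ?R s \<noteq> 0"
    using sk assms(2) by simp
  then show ne: "?R \<noteq> 0"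
    by (auto simp: wronskian_def)
  have "degree ?R \<le> n"
    unfolding R n_def by (rule degree_combination_le)
  moreover have "coeff ?R n = 0"
    by (simp add: R)
  ultimately show less: "degree ?R < n"
    using ne by (metis leading_coeff_0_iff le_neq_implies_less)
  have "degree (wronskian ?R s) = degree ?R + n - 1"
    using degree_wronskian[OF ne] less sk(1) by simp
  then show "degree (wronskian p q) = degree ?R + n - 1"
    using sk by simp
qed

section \<open>Factorization through a power\<close>

lemma degree_eq_sum_order:
  fixes p :: "complex poly"
  assumes "p \<noteq> 0"
  shows "degree p = (\<Sum>z | poly p z = 0. Polynomial.order z p)"
proof -
  have "degree p = degree (smult (lead_coeff p) (\<Prod>z | poly p z = 0. [:- z, 1:] ^ Polynomial.order z p))"
    by (simp only: complex_poly_decompose)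
  also have "\<dots> = degree (\<Prod>z | poly p z = 0. [:- z, 1:] ^ Polynomial.order z p)"
    using assms by simp
  also have "\<dots> = (\<Sum>z | poly p z = 0. degree ([:- z, 1:] ^ Polynomial.order z p))"
    by (rule degree_prod_eq_sum_degree) simp
  finally show ?thesis
    by (simp add: degree_power_eq)
qed

lemma rat_map_smult_smult:
  assumes "k \<noteq> 0" "l \<noteq> 0" "coprime p q"
  shows "rat_map (smult k p) (smult l q) = rat_map [:0, k:] [:l, 0:] \<circ> rat_map p q"
  using moebius_comp_rat_map(2)[of k l 0 0 p q] assms by simp

text \<open>Composing with \<open>?T\<close> makes numerator and denominator scalar multiples of
  \<open>n\<close>-th powers of linear forms. The scalars go into \<open>?S\<close>, and
  \<open>?T\<close> is undone at the end.\<close>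

lemma factor_through_power:
  assumes "n > 0" "coprime p q" "\<alpha> * \<delta> - \<beta> * \<gamma> \<noteq> 0" "a * d - b * c \<noteq> 0" "k \<noteq> 0" "l \<noteq> 0"
    and "smult \<alpha> p + smult \<beta> q = smult k ([:b, a:] ^ n)"
    and "smult \<gamma> p + smult \<delta> q = smult l ([:d, c:] ^ n)"
  shows "\<exists>M. moebius M \<and> rat_map p q = M \<circ> pw n \<circ> rat_map [:b, a:] [:d, c:]"
proof -
  let ?T = "rat_map [:\<beta>, \<alpha>:] [:\<delta>, \<gamma>:]" and ?N = "rat_map [:b, a:] [:d, c:]"
    and ?S = "rat_map [:0, k:] [:l, 0:]"
  have "?T \<circ> rat_map p q = rat_map (smult k ([:b, a:] ^ n)) (smult l ([:d, c:] ^ n))"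
    using moebius_comp_rat_map(2)[OF assms(3,2)] assms(7,8) by simp
  also have "\<dots> = ?S \<circ> rat_map ([:b, a:] ^ n) ([:d, c:] ^ n)"
    using assms(5,6) coprime_moebius[OF assms(4)]
    by (intro rat_map_smult_smult) simp_all
  also have "\<dots> = ?S \<circ> (pw n \<circ> ?N)"
    by (simp add: pw_comp_rat_map[OF assms(1)])
  finally have e: "?T \<circ> rat_map p q = ?S \<circ> (pw n \<circ> ?N)" .
  have "moebius ?T"
    using assms(3) by (rule moebiusI) simp
  then obtain T' where T': "moebius T'" "T' \<circ> ?T = id"
    by (rule moebius_inverse)
  have "moebius ?S"
    using assms(5,6) by (intro moebiusI[of k l 0 0]) simp_all
  moreover have "rat_map p q = T' \<circ> ?S \<circ> pw n \<circ> ?N"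
    using arg_cong[OF e, of "\<lambda>h. T' \<circ> h"] by (simp add: T'(2) flip: o_assoc) (simp add: T'(2) o_assoc)
  ultimately show ?thesis
    using T'(1) by blast
qed

text \<open>The multiplicities of the critical points, with the degree deficit of the Wronskian
  counted at infinity, add up to \<open>2 * n - 2\<close>, and each is at most \<open>n - 1\<close>.
  Hence two critical points both attain \<open>n - 1\<close>, and their fibre polynomials are
  powers.\<close>

lemma bicritical_factorization:
  assumes "bicritical f" "rat_degree f = n"
  obtains M N a b where "n > 0" "moebius M" "moebius N" "f = M \<circ> pw n \<circ> N"
    "critical_points f = {a, b}" "N a = Some 0" "N b = None"
proof -
  obtain p q where pq: "coprime p q" and f: "f = rat_map p q"
    using assms(1) unfolding bicritical_def rational_map_def by blast
  have n: "n = max (degree p) (degree q)"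
    using assms(2) rat_degree_rat_map[OF pq] f by simp
  have card: "card (critical_points f) = 2"
    using assms(1) by (simp add: bicritical_def)
  let ?W = "wronskian p q" and ?C = "critical_points f"
  have crit: "Some z \<in> ?C \<longleftrightarrow> poly ?W z = 0" for z
    unfolding f by (rule critical_point_finite_iff[OF pq])
  have W0: "?W \<noteq> 0"
  proof
    assume "?W = 0"
    then have "range Some \<subseteq> ?C"
      using crit by auto
    moreover have "infinite (range (Some :: complex \<Rightarrow> _))"
      by (simp add: finite_image_iff infinite_UNIV_char_0)
    ultimately have "infinite ?C"
      using finite_subset by blast
    then show False
      using card by simp
  qed
  note le = order_wronskian_le[OF pq W0, folded n]
  have n0: "n > 0"
    using le[of 0] by simp
  have inf: "infinite_fibre p q \<noteq> 0" "degree (infinite_fibre p q) < n"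
    "degree ?W = degree (infinite_fibre p q) + n - 1"
    using infinite_fibre_degree[OF pq W0] by (simp_all add: n)
  have R: "infinite_fibre p q = smult (coeff q n) p + smult (- coeff p n) q"
    by (simp add: infinite_fibre_def n Let_def)
  have roots: "{z. poly ?W z = 0} = Some -` ?C"
    using crit by auto
  have degW: "degree ?W = (\<Sum>z\<in>Some -` ?C. Polynomial.order z ?W)"
    using degree_eq_sum_order[OF W0] by (simp only: roots)
  show ?thesis
  proof (cases "None \<in> ?C")
    case True
    obtain u v where uv: "?C = {u, v}" "u \<noteq> v"
      using card card_2_iff by metis
    with True obtain x where x: "?C = {Some x, None}"
      by (cases u; cases v) (auto simp: insert_commute)
    have "Some -` ?C = {x}"
      unfolding x by auto
    then have "degree ?W = Polynomial.order x ?W"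
      using degW by simp
    then have d0: "degree (infinite_fibre p q) = 0" and o: "Suc (Polynomial.order x ?W) = n"
      using inf(3) le[of x] n0 by auto
    obtain l where l: "infinite_fibre p q = [:l:]" "l \<noteq> 0"
      using d0 inf(1) by (metis degree_eq_zeroE pCons_0_0)
    obtain k where k: "k \<noteq> 0" "finite_fibre p q x = smult k ([:- x, 1:] ^ n)"
      using finite_fibre_eq_power[OF pq W0] o unfolding n by blast
    \<comment> \<open>The determinant of the change of pair is the value at \<open>x\<close> of the
      constant fibre polynomial.\<close>
    have "poly (infinite_fibre p q) x = l"
      by (simp add: l)
    then have "poly q x * (- coeff p n) - (- poly p x) * coeff q n = l"
      by (simp add: R algebra_simps)
    then have "poly q x * (- coeff p n) - (- poly p x) * coeff q n \<noteq> 0"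
      using l by simp
    moreover have "smult (poly q x) p + smult (- poly p x) q = smult k ([:- x, 1:] ^ n)"
      using k by (simp add: finite_fibre_def)
    \<comment> \<open>The constant 1 is written as the linear form \<open>[:1, 0:]\<close>, so the
      inner Moebius map is the translation z - x, which fixes infinity.\<close>
    moreover have "smult (coeff q n) p + smult (- coeff p n) q = smult l ([:1, 0:] ^ n)"
      using l R by (simp flip: one_pCons)
    moreover have D: "(1::complex) * 1 - (- x) * 0 \<noteq> 0"
      by simp
    ultimately obtain M where M: "moebius M" "f = M \<circ> pw n \<circ> rat_map [:- x, 1:] [:1, 0:]"
      using factor_through_power[OF n0 pq _ D k(1) l(2)] unfolding f by blast
    show ?thesis
    proof (rule that[OF n0 M(1) _ M(2) x])
      show "moebius (rat_map [:- x, 1:] [:1, 0:])"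
        using D by (rule moebiusI) simp
    qed (simp_all only: rat_map_moebius[OF D], simp_all)
  next
    case False
    obtain u v where uv: "?C = {u, v}" "u \<noteq> v"
      using card card_2_iff by metis
    with False obtain x y where xy: "?C = {Some x, Some y}" "x \<noteq> y"
      by (cases u; cases v) auto
    \<comment> \<open>As infinity is not critical, the Wronskian has full degree
      \<open>2 * n - 2\<close>, all of it at two finite points.\<close>
    have "coeff (infinite_fibre p q) (n - 1) \<noteq> 0"
      using critical_point_infinityI[OF pq n n0] False unfolding R f by auto
    then have "degree (infinite_fibre p q) = n - 1"
      using inf(2) by (metis le_degree Suc_diff_1 less_Suc_eq_le le_antisym n0)
    then have "degree ?W = (n - 1) + (n - 1)"
      using inf(3) n0 by simp
    moreover have "Some -` ?C = {x, y}"
      unfolding xy by auto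
    then have "degree ?W = Polynomial.order x ?W + Polynomial.order y ?W"
      using degW xy(2) by simp
    ultimately have o: "Suc (Polynomial.order x ?W) = n" "Suc (Polynomial.order y ?W) = n"
      using le[of x] le[of y] by linarith+
    obtain k where k: "k \<noteq> 0" "finite_fibre p q x = smult k ([:- x, 1:] ^ n)"
      using finite_fibre_eq_power[OF pq W0] o(1) unfolding n by blast
    obtain l where l: "l \<noteq> 0" "finite_fibre p q y = smult l ([:- y, 1:] ^ n)"
      using finite_fibre_eq_power[OF pq W0] o(2) unfolding n by blast
    \<comment> \<open>The determinant is the value at \<open>x\<close> of the fibre polynomial
      through \<open>y\<close>, whose only root is \<open>y\<close>.\<close>
    have "poly q x * (- poly p y) - (- poly p x) * poly q y = poly (finite_fibre p q y) x"
      by (simp add: finite_fibre_def algebra_simps)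
    also have "\<dots> \<noteq> 0"
      using l xy(2) by simp
    finally have E: "poly q x * (- poly p y) - (- poly p x) * poly q y \<noteq> 0" .
    have D: "(1::complex) * (- y) - (- x) * 1 \<noteq> 0"
      using xy(2) by simp
    obtain M where M: "moebius M" "f = M \<circ> pw n \<circ> rat_map [:- x, 1:] [:- y, 1:]"
      using factor_through_power[OF n0 pq E D k(1) l(1)] k(2) l(2) unfolding f finite_fibre_def by blast
    show ?thesis
    proof (rule that[OF n0 M(1) _ M(2) xy(1)])
      show "moebius (rat_map [:- x, 1:] [:- y, 1:])"
        using D by (rule moebiusI) simp
    qed (simp_all only: rat_map_moebius[OF D], use xy(2) in simp_all)
  qed
qed

section \<open>Recognizing cyclic and dihedral groups\<close>

lemma (in group) nat_pow_mod_eq: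
  fixes n :: nat
  assumes "r \<in> carrier G" "r [^] n = \<one>"
  shows "r [^] (i mod n) = r [^] i"
proof -
  have "r [^] i = (r [^] n) [^] (i div n) \<otimes> r [^] (i mod n)"
    using assms(1) by (simp add: nat_pow_pow nat_pow_mult)
  then show ?thesis
    using assms by simp
qed

text \<open>The powers of \<open>r\<close> give a surjective homomorphism between groups of equal
  finite order, so injectivity follows by counting.\<close>

lemma (in group) iso_integer_mod_groupI:
  fixes n :: nat
  assumes "r \<in> carrier G" "r [^] n = \<one>" "n > 0"
    and "carrier G \<subseteq> range (\<lambda>i::nat. r [^] i)" "card (carrier G) = n"
  shows "G \<cong> integer_mod_group n"
proof -
  note mod = nat_pow_mod_eq[OF assms(1,2)]
  let ?h = "\<lambda>i::int. r [^] nat i"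
  have "?h \<in> hom (integer_mod_group n) G"
  proof (rule homI)
    fix x y
    assume "x \<in> carrier (integer_mod_group n)" "y \<in> carrier (integer_mod_group n)"
    then have "0 \<le> x" "0 \<le> y"
      using assms(3) by (auto simp: carrier_integer_mod_group)
    then have "nat ((x + y) mod int n) = (nat x + nat y) mod n"
      by (simp add: nat_mod_distrib nat_add_distrib)
    then show "?h (x \<otimes>\<^bsub>integer_mod_group n\<^esub> y) = ?h x \<otimes> ?h y"
      using assms(1) by (simp add: mod nat_pow_mult)
  qed (use assms(1) in simp)
  moreover have "bij_betw ?h (carrier (integer_mod_group n)) (carrier G)"
  proof -
    have im: "?h ` carrier (integer_mod_group n) = carrier G"
    proof
      show "carrier G \<subseteq> ?h ` carrier (integer_mod_group n)"
      proof
        fix g assume "g \<in> carrier G"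
        then obtain i where "g = r [^] (i::nat)"
          using assms(4) by blast
        then have "g = ?h (int (i mod n))"
          using mod by simp
        moreover have "int (i mod n) \<in> carrier (integer_mod_group n)"
          using assms(3) by (simp add: carrier_integer_mod_group)
        ultimately show "g \<in> ?h ` carrier (integer_mod_group n)"
          by blast
      qed
    qed (use assms(1) in auto)
    have "card (carrier (integer_mod_group n)) = n"
      using assms(3) by (simp add: carrier_integer_mod_group)
    then have "inj_on ?h (carrier (integer_mod_group n))"
      using assms(3,5) im by (intro eq_card_imp_inj_on) (auto simp: carrier_integer_mod_group)
    then show ?thesis
      using im by (simp add: bij_betw_def)
  qed
  ultimately have "integer_mod_group n \<cong> G"
    by (intro is_isoI isoI) auto
  then show ?thesis
    by (rule group.iso_sym[OF group_integer_mod_group])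
qed

section \<open>Words in the dihedral generators\<close>

fun (in group) letter_value :: "'a \<Rightarrow> 'a \<Rightarrow> dihedral_gen \<times> bool \<Rightarrow> 'a" where
  "letter_value r s (Rot, b) = (if b then r else inv r)"
| "letter_value r s (Flip, b) = (if b then s else inv s)"

primrec (in group) word_value :: "'a \<Rightarrow> 'a \<Rightarrow> (dihedral_gen \<times> bool) list \<Rightarrow> 'a" where
  "word_value r s [] = \<one>"
| "word_value r s (l # w) = letter_value r s l \<otimes> word_value r s w"

context group
begin

context
  fixes r s
  assumes rs: "r \<in> carrier G" "s \<in> carrier G"
begin

lemma letter_value_closed: "letter_value r s l \<in> carrier G"
  using rs by (cases "(r, s, l)" rule: letter_value.cases) auto

lemma word_value_closed: "word_value r s w \<in> carrier G"
  by (induction w) (auto simp: letter_value_closed)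

lemma word_value_append: "word_value r s (u @ v) = word_value r s u \<otimes> word_value r s v"
  by (induction u) (auto simp: letter_value_closed word_value_closed m_assoc)

lemma word_value_replicate: "word_value r s (replicate n (Rot, True)) = r [^] n"
  by (induction n) (simp_all add: rs nat_pow_Suc2[symmetric])

text \<open>Makes evaluation well defined on a presented group: each generating step of the
  congruence deletes a subword of value \<open>\<one>\<close>.\<close>

lemma word_value_pres_eq:
  assumes "pres_eq rels u v" "\<And>w. w \<in> rels \<Longrightarrow> word_value r s w = \<one>"
  shows "word_value r s u = word_value r s v"
  using assms(1)
proof (induction rule: pres_eq.induct)
  case (cancel u x b v)
  have "letter_value r s (x, b) \<otimes> (letter_value r s (x, \<not> b) \<otimes> word_value r s v) = word_value r s v"
    using rs by (cases x) (auto simp: word_value_closed m_assoc[symmetric])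
  then show ?case
    by (simp add: word_value_append)
next
  case (relator w u v)
  then show ?case
    using assms(2) by (simp add: word_value_append word_value_closed)
qed auto

end

end

text \<open>The relators give s r = r^(-1) s, so left multiplication by a letter keeps the shape r^i
  s^j.\<close>

lemma (in group) dihedral_normal_form:
  fixes n :: nat
  assumes "r \<in> carrier G" "s \<in> carrier G" "r [^] n = \<one>" "s \<otimes> s = \<one>" "r \<otimes> s \<otimes> r \<otimes> s = \<one>" "n > 0"
  shows "word_value r s w \<in> (\<lambda>(i, j). r [^] i \<otimes> s [^] j) ` ({..<n} \<times> {..<2::nat})"
proof -
  have invs: "inv s = s"
    using assms(2,4) by (simp add: inv_equality)
  have sr: "s \<otimes> r = inv r \<otimes> s"
  proof -
    have "r \<otimes> (s \<otimes> r) = inv s"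
      using assms(1,2,5) by (intro inv_equality[symmetric]) (simp_all add: m_assoc)
    then have "r \<otimes> (s \<otimes> r) = s"
      using invs by simp
    then have "inv r \<otimes> (r \<otimes> (s \<otimes> r)) = inv r \<otimes> s"
      by simp
    then show ?thesis
      using assms(1,2) by (simp add: m_assoc[symmetric])
  qed
  have srp: "s \<otimes> r [^] i = inv r [^] i \<otimes> s" for i :: nat
  proof (induction i)
    case (Suc i)
    have "s \<otimes> r [^] Suc i = (s \<otimes> r [^] i) \<otimes> r"
      using assms(1,2) by (simp add: m_assoc)
    also have "\<dots> = inv r [^] i \<otimes> (s \<otimes> r)"
      using assms(1,2) unfolding Suc by (simp add: m_assoc)
    also have "\<dots> = inv r [^] Suc i \<otimes> s"
      using assms(1,2) unfolding sr by (simp add: m_assoc)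
    finally show ?case .
  qed (use assms(1,2) in simp)
  note mod = nat_pow_mod_eq[OF assms(1,3)]
  \<comment> \<open>Normal forms use natural exponents only, so the inverse is written as a
    power.\<close>
  have invr: "inv r = r [^] (n - 1)"
  proof (rule inv_equality)
    show "r [^] (n - 1) \<otimes> r = \<one>"
      using assms(3,6) nat_pow_Suc[of r "n - 1"] by simp
  qed (use assms(1) in auto)
  let ?S = "(\<lambda>(i, j). r [^] i \<otimes> s [^] j) ` ({..<n} \<times> {..<2::nat})"
  have spow: "s [^] Suc j = s [^] ((Suc j) mod 2)" if "j < 2" for j
    using that assms(2,4) by (auto simp: less_2_cases_iff)
  have S: "r [^] i \<otimes> s [^] j \<in> ?S" if "j < 2" for i j :: nat
  proof -
    have "r [^] i \<otimes> s [^] j = (\<lambda>(i, j). r [^] i \<otimes> s [^] j) (i mod n, j)"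
      by (simp add: mod)
    moreover have "(i mod n, j) \<in> {..<n} \<times> {..<2}"
      using assms(6) that by auto
    ultimately show ?thesis
      by blast
  qed
  show ?thesis
  proof (induction w)
    case Nil
    then show ?case
      using S[of 0 0] by simp
  next
    case (Cons l w)
    then obtain i j :: nat where ij: "word_value r s w = r [^] i \<otimes> s [^] j" "j < 2"
      by auto
    have sj: "s [^] j \<in> carrier G"
      using assms(2) by simp
    have "letter_value r s l \<in> {r, inv r, s}"
      by (cases "(r, s, l)" rule: letter_value.cases) (auto simp: invs)
    then consider "letter_value r s l = r" | "letter_value r s l = inv r" | "letter_value r s l = s"
      by auto
    then show ?case
    proof cases
      case 1
      have "word_value r s (l # w) = r [^] Suc i \<otimes> s [^] j"
        by (simp only: word_value.simps 1 ij(1) nat_pow_Suc2[OF assms(1)] m_assoc assms(1) sj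
            nat_pow_closed)
      then show ?thesis
        using S ij(2) by metis
    next
      case 2
      then have "word_value r s (l # w) = r [^] (n - 1 + i) \<otimes> s [^] j"
        using assms(1) sj ij by (simp add: invr nat_pow_mult[symmetric] m_assoc)
      then show ?thesis
        using S ij(2) by metis
    next
      case 3
      then have "word_value r s (l # w) = (s \<otimes> r [^] i) \<otimes> s [^] j"
        using assms(1,2) sj ij by (simp add: m_assoc)
      also have "\<dots> = inv r [^] i \<otimes> (s \<otimes> s [^] j)"
        using assms(1,2) sj unfolding srp by (simp add: m_assoc)
      also have "\<dots> = r [^] ((n - 1) * i) \<otimes> s [^] (Suc j mod 2)"
        using assms(1) spow[OF ij(2)] nat_pow_Suc2[OF assms(2)] unfolding invr
        by (simp only: nat_pow_pow)
      finally show ?thesis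
        using S[of "Suc j mod 2"] by simp
    qed
  qed
qed

text \<open>Normal forms in the presented group itself, where evaluating a word at the generators
  returns its class. A group of order \<open>2 * n\<close> satisfying the relations supplies the
  lower bound in \<open>iso_dihedral_groupI\<close>.\<close>

lemma card_dihedral_group_le:
  assumes "n > 0"
  shows "finite (carrier (dihedral_group n))" "card (carrier (dihedral_group n)) \<le> 2 * n"
proof -
  let ?rels = "{replicate n (Rot, True), [(Flip, True), (Flip, True)],
    [(Rot, True), (Flip, True), (Rot, True), (Flip, True)]}"
  let ?r = "pres_class ?rels [(Rot, True)]" and ?s = "pres_class ?rels [(Flip, True)]"
  interpret P: group "dihedral_group n"
    unfolding dihedral_group_def by (rule group_presented_group)
  have mult: "pres_class ?rels u \<otimes>\<^bsub>dihedral_group n\<^esub> pres_class ?rels v = pres_class ?rels (u @ v)" for u v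
    unfolding dihedral_group_def by (rule mult_presented_group)
  have one: "\<one>\<^bsub>dihedral_group n\<^esub> = pres_class ?rels []"
    unfolding dihedral_group_def by (rule one_presented_group)
  have carr: "carrier (dihedral_group n) = range (pres_class ?rels)"
    unfolding dihedral_group_def by (rule carrier_presented_group)
  have rs: "?r \<in> carrier (dihedral_group n)" "?s \<in> carrier (dihedral_group n)"
    unfolding carr by auto
  have rel: "pres_class ?rels w = \<one>\<^bsub>dihedral_group n\<^esub>" if "w \<in> ?rels" for w
    unfolding one pres_class_eq_iff using pres_eq.relator[OF that, of "[]" "[]"] by simp
  have inv: "inv\<^bsub>dihedral_group n\<^esub> (pres_class ?rels [(x, True)]) = pres_class ?rels [(x, False)]" for x
  proof (rule P.inv_equality)
    show "pres_class ?rels [(x, False)] \<otimes>\<^bsub>dihedral_group n\<^esub> pres_class ?rels [(x, True)] = \<one>\<^bsub>dihedral_group n\<^esub>"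
      unfolding mult one pres_class_eq_iff using pres_eq.cancel[of ?rels "[]" x False "[]"] by simp
  qed (auto simp: carr)
  have letter: "P.letter_value ?r ?s l = pres_class ?rels [l]" for l
    by (cases "(?r, ?s, l)" rule: P.letter_value.cases) (auto simp: inv)
  have word: "P.word_value ?r ?s w = pres_class ?rels w" for w
    by (induction w) (simp_all add: one letter mult)
  have "?r [^]\<^bsub>dihedral_group n\<^esub> n = pres_class ?rels (replicate n (Rot, True))"
    using P.word_value_replicate[OF rs] word by metis
  then have rn: "?r [^]\<^bsub>dihedral_group n\<^esub> n = \<one>\<^bsub>dihedral_group n\<^esub>"
    using rel by simp
  have ss: "?s \<otimes>\<^bsub>dihedral_group n\<^esub> ?s = \<one>\<^bsub>dihedral_group n\<^esub>"
    unfolding mult using rel by simp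
  have rsrs: "?r \<otimes>\<^bsub>dihedral_group n\<^esub> ?s \<otimes>\<^bsub>dihedral_group n\<^esub> ?r \<otimes>\<^bsub>dihedral_group n\<^esub> ?s = \<one>\<^bsub>dihedral_group n\<^esub>"
    unfolding mult using rel by simp
  let ?f = "\<lambda>(i, j). ?r [^]\<^bsub>dihedral_group n\<^esub> i \<otimes>\<^bsub>dihedral_group n\<^esub> ?s [^]\<^bsub>dihedral_group n\<^esub> j"
  have sub: "carrier (dihedral_group n) \<subseteq> ?f ` ({..<n} \<times> {..<2::nat})"
  proof
    fix x assume "x \<in> carrier (dihedral_group n)"
    then obtain w where "x = P.word_value ?r ?s w"
      unfolding carr using word by (metis imageE)
    then show "x \<in> ?f ` ({..<n} \<times> {..<2::nat})"
      using P.dihedral_normal_form[OF rs rn ss rsrs assms] by simp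
  qed
  then show "finite (carrier (dihedral_group n))"
    by (rule finite_subset) simp
  have "card (carrier (dihedral_group n)) \<le> card (?f ` ({..<n} \<times> {..<2::nat}))"
    using sub by (intro card_mono) simp_all
  also have "\<dots> \<le> card ({..<n} \<times> {..<2::nat})"
    by (intro card_image_le) simp
  finally show "card (carrier (dihedral_group n)) \<le> 2 * n"
    by simp
qed

text \<open>Evaluation maps the presented group onto \<open>G\<close>. As it has at most
  \<open>2 * n\<close> elements and \<open>G\<close> has exactly that many, the map is
  injective.\<close>

lemma (in group) iso_dihedral_groupI:
  fixes n :: nat
  assumes "r \<in> carrier G" "s \<in> carrier G" "r [^] n = \<one>" "s \<otimes> s = \<one>" "r \<otimes> s \<otimes> r \<otimes> s = \<one>" "n > 0"
    and "carrier G \<subseteq> range (\<lambda>i::nat. r [^] i) \<union> range (\<lambda>i::nat. r [^] i \<otimes> s)"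
    and "card (carrier G) = 2 * n"
  shows "G \<cong> dihedral_group n"
proof -
  let ?rels = "{replicate n (Rot, True), [(Flip, True), (Flip, True)],
    [(Rot, True), (Flip, True), (Rot, True), (Flip, True)]}"
  let ?D = "dihedral_group n" and ?v = "word_value r s"
  interpret P: group ?D
    unfolding dihedral_group_def by (rule group_presented_group)
  have mult: "pres_class ?rels u \<otimes>\<^bsub>?D\<^esub> pres_class ?rels v = pres_class ?rels (u @ v)" for u v
    unfolding dihedral_group_def by (rule mult_presented_group)
  have carr: "carrier ?D = range (pres_class ?rels)"
    unfolding dihedral_group_def by (rule carrier_presented_group)
  have v_eq: "?v u = ?v w" if "pres_class ?rels u = pres_class ?rels w" for u w
    using that unfolding pres_class_eq_iff
    by (rule word_value_pres_eq[OF assms(1,2)])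
      (use assms(1-5) in \<open>auto simp: word_value_replicate[OF assms(1,2)] m_assoc\<close>)
  \<comment> \<open>By \<open>v_eq\<close> the value does not depend on the chosen
    representative.\<close>
  define h where "h A = ?v (SOME w. pres_class ?rels w = A)" for A
  have h: "h (pres_class ?rels w) = ?v w" for w
    unfolding h_def by (rule v_eq, rule someI) simp
  have "h \<in> hom ?D G"
    unfolding hom_def carr
    by (auto simp: h mult word_value_closed[OF assms(1,2)] word_value_append[OF assms(1,2)])
  moreover have "bij_betw h (carrier ?D) (carrier G)"
  proof -
    have im: "h ` carrier ?D = carrier G"
    proof
      show "h ` carrier ?D \<subseteq> carrier G"
        unfolding carr by (auto simp: h word_value_closed[OF assms(1,2)])
      show "carrier G \<subseteq> h ` carrier ?D"
      proof
        fix g assume "g \<in> carrier G"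
        then obtain i where "g = r [^] (i::nat) \<or> g = r [^] (i::nat) \<otimes> s"
          using assms(7) by blast
        then have "g = ?v (replicate i (Rot, True)) \<or> g = ?v (replicate i (Rot, True) @ [(Flip, True)])"
          using assms(1,2) by (auto simp: word_value_replicate word_value_append)
        then show "g \<in> h ` carrier ?D"
          unfolding carr using h by (metis rangeI image_eqI)
      qed
    qed
    note fin = card_dihedral_group_le[OF assms(6)]
    have "card (carrier G) \<le> card (carrier ?D)"
      using card_image_le[OF fin(1), of h] im by simp
    then have "card (h ` carrier ?D) = card (carrier ?D)"
      using fin(2) assms(8) im by simp
    then have "inj_on h (carrier ?D)"
      using fin(1) by (intro eq_card_imp_inj_on)
    then show ?thesis
      using im by (simp add: bij_betw_def)
  qed
  ultimately have "?D \<cong> G"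
    by (intro is_isoI isoI) auto
  then show ?thesis
    by (rule P.iso_sym)
qed

section \<open>Deck groups of iterates\<close>

lemma carrier_Deck: "carrier (Deck F) = {\<mu>. moebius \<mu> \<and> F \<circ> \<mu> = F}"
  by (simp add: Deck_def)

lemma mult_Deck [simp]: "\<mu> \<otimes>\<^bsub>Deck F\<^esub> \<nu> = \<mu> \<circ> \<nu>"
  by (simp add: Deck_def)

lemma one_Deck [simp]: "\<one>\<^bsub>Deck F\<^esub> = id"
  by (simp add: Deck_def)

lemma group_Deck: "group (Deck F)"
proof (rule groupI)
  fix \<mu> assume "\<mu> \<in> carrier (Deck F)"
  then have \<mu>: "moebius \<mu>" "F \<circ> \<mu> = F"
    by (simp_all add: carrier_Deck)
  obtain \<nu> where \<nu>: "moebius \<nu>" "\<nu> \<circ> \<mu> = id" "\<mu> \<circ> \<nu> = id"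
    using \<mu>(1) by (rule moebius_inverse)
  have "F \<circ> \<nu> = F \<circ> \<mu> \<circ> \<nu>"
    by (simp only: \<mu>(2))
  also have "\<dots> = F"
    by (simp only: comp_assoc \<nu>(3) comp_id)
  finally show "\<exists>\<nu>\<in>carrier (Deck F). \<nu> \<otimes>\<^bsub>Deck F\<^esub> \<mu> = \<one>\<^bsub>Deck F\<^esub>"
    using \<nu> by (auto simp: carrier_Deck)
next
  fix \<mu> \<nu> assume "\<mu> \<in> carrier (Deck F)" "\<nu> \<in> carrier (Deck F)"
  then show "\<mu> \<otimes>\<^bsub>Deck F\<^esub> \<nu> \<in> carrier (Deck F)"
    by (auto simp: carrier_Deck o_assoc)
qed (auto simp: carrier_Deck o_assoc)

lemma Deck_conj_iso:
  assumes "moebius N" "moebius N'" "N' \<circ> N = id" "N \<circ> N' = id"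
  shows "Deck (N' \<circ> F \<circ> N) \<cong> Deck F"
proof -
  have N'N: "N' (N x) = x" and NN': "N (N' x) = x" for x
    using assms(3,4) by (metis comp_apply id_apply)+
  let ?h = "\<lambda>\<mu>. N \<circ> \<mu> \<circ> N'"
  have "?h \<in> hom (Deck (N' \<circ> F \<circ> N)) (Deck F)"
  proof (rule homI)
    fix \<mu> assume "\<mu> \<in> carrier (Deck (N' \<circ> F \<circ> N))"
    then have \<mu>: "moebius \<mu>" "N' (F (N (\<mu> x))) = N' (F (N x))" for x
      by (auto simp: carrier_Deck fun_eq_iff)
    have "F (N (\<mu> (N' x))) = F x" for x
      using \<mu>(2)[of "N' x"] NN' by metis
    then show "?h \<mu> \<in> carrier (Deck F)"
      using \<mu>(1) assms(1,2) by (auto simp: carrier_Deck fun_eq_iff)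
  qed (auto simp: fun_eq_iff N'N)
  moreover have "bij_betw ?h (carrier (Deck (N' \<circ> F \<circ> N))) (carrier (Deck F))"
  proof (rule bij_betw_byWitness[where f' = "\<lambda>\<mu>. N' \<circ> \<mu> \<circ> N"])
    show "(\<lambda>\<mu>. N' \<circ> \<mu> \<circ> N) ` carrier (Deck F) \<subseteq> carrier (Deck (N' \<circ> F \<circ> N))"
    proof clarify
      fix \<mu> assume "\<mu> \<in> carrier (Deck F)"
      then have \<mu>: "moebius \<mu>" "F (\<mu> x) = F x" for x
        by (auto simp: carrier_Deck fun_eq_iff)
      then show "N' \<circ> \<mu> \<circ> N \<in> carrier (Deck (N' \<circ> F \<circ> N))"
        using assms(1,2) by (auto simp: carrier_Deck fun_eq_iff NN')
    qed
    show "?h ` carrier (Deck (N' \<circ> F \<circ> N)) \<subseteq> carrier (Deck F)"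
      using \<open>?h \<in> hom _ _\<close> by (auto simp: hom_def)
  qed (auto simp: fun_eq_iff N'N NN')
  ultimately show ?thesis
    by (intro is_isoI isoI) auto
qed

lemma nonzero_if_power_eq_1: "(a::complex) ^ n = 1 \<Longrightarrow> n > 0 \<Longrightarrow> a \<noteq> 0"
  by (metis power_0_left zero_neq_one not_gr0)

lemma roots_of_unity_generator:
  assumes "n > 0"
  obtains \<omega> :: complex where "\<omega> ^ n = 1" "{z. z ^ n = 1} = range (\<lambda>i. \<omega> ^ i)"
proof -
  define \<omega> where "\<omega> = exp (2 * of_real pi * \<i> * of_nat 1 / of_nat n)"
  have pow: "exp (2 * of_real pi * \<i> * of_nat j / of_nat n) = \<omega> ^ j" for j
    unfolding \<omega>_def exp_of_nat_mult[symmetric] by (simp add: mult_ac)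
  have roots: "{z::complex. z ^ n = 1} = {\<omega> ^ j | j. j < n}"
    using complex_roots_unity[of n] assms unfolding pow by simp
  have "\<omega> ^ n = 1"
    unfolding pow[symmetric] using assms exp_two_pi_i by simp
  then have "\<omega> ^ i \<in> {z. z ^ n = 1}" for i
    by (simp add: power_mult[symmetric] mult.commute[of i]) (simp add: power_mult)
  then have "{z. z ^ n = 1} = range (\<lambda>i. \<omega> ^ i)"
    using roots by auto
  then show ?thesis
    using that \<open>\<omega> ^ n = 1\<close> by blast
qed

lemma card_roots_of_unity: "n > 0 \<Longrightarrow> finite {z::complex. z ^ n = 1} \<and> card {z::complex. z ^ n = 1} = n"
  by (simp add: card_roots_unity_eq finite_roots_unity Suc_leI)

section \<open>Iterates of a Moebius map after a power\<close>

locale power_composition =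
  fixes M M' :: "sphere \<Rightarrow> sphere" and d :: nat
  assumes moebius_M: "moebius M" and moebius_M': "moebius M'"
    and M'_M: "M' \<circ> M = id" and M_M': "M \<circ> M' = id"
    and d_pos: "d > 0"
begin

definition g :: "sphere \<Rightarrow> sphere" where
  "g = M \<circ> pw d"

definition G :: "nat \<Rightarrow> (sphere \<Rightarrow> sphere) set" where
  "G k = {\<mu>. moebius \<mu> \<and> (g ^^ k) \<circ> \<mu> = g ^^ k}"

lemma G_iff: "\<mu> \<in> G k \<longleftrightarrow> moebius \<mu> \<and> (\<forall>x. (g ^^ k) (\<mu> x) = (g ^^ k) x)"
  by (auto simp: G_def fun_eq_iff)

lemma M'_M_apply [simp]: "M' (M x) = x" and M_M'_apply [simp]: "M (M' x) = x"
  using M'_M M_M' by (metis comp_apply id_apply)+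

lemma M_eq_iff [simp]: "M x = M y \<longleftrightarrow> x = y"
  by (metis M'_M_apply)

lemma g_apply: "g x = M (pw d x)"
  by (simp add: g_def)

lemma rational_map_iterate:
  assumes "moebius \<mu>"
  shows "rational_map ((g ^^ k) \<circ> \<mu>)"
proof (induction k)
  case 0
  then show ?case
    using assms by (simp add: rational_map_moebius)
next
  case (Suc k)
  have "(g ^^ Suc k) \<circ> \<mu> = M \<circ> (pw d \<circ> ((g ^^ k) \<circ> \<mu>))"
    by (simp add: g_def o_assoc)
  then show ?case
    using Suc moebius_M d_pos by (simp only: rational_map_moebius_comp rational_map_pw_comp)
qed

text \<open>Cancelling the outer \<open>M\<close> leaves two rational maps with equal
  \<open>d\<close>-th powers; these differ by a constant root of unity.\<close>

lemma G_SucD: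
  assumes "\<mu> \<in> G (Suc k)"
  obtains \<rho> where "\<rho> ^ d = 1" "\<And>x. (g ^^ k) (\<mu> x) = rot \<rho> ((g ^^ k) x)"
proof -
  have "pw d \<circ> ((g ^^ k) \<circ> \<mu>) = pw d \<circ> ((g ^^ k) \<circ> id)"
    using assms by (auto simp: G_iff fun_eq_iff g_apply)
  moreover have "moebius \<mu>"
    using assms by (simp add: G_iff)
  ultimately obtain \<rho> where "\<rho> ^ d = 1" "(g ^^ k) \<circ> \<mu> = rot \<rho> \<circ> ((g ^^ k) \<circ> id)"
    using pw_comp_eq_imp_rot[OF d_pos] rational_map_iterate moebius_id by blast
  then show ?thesis
    using that by (simp add: fun_eq_iff)
qed

lemma G_0: "G 0 = {id}"
  by (auto simp: G_def)

lemma G_mono: "i \<le> j \<Longrightarrow> G i \<subseteq> G j"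
proof (induction rule: dec_induct)
  case (step j)
  then show ?case
    by (auto simp: G_iff)
qed simp

lemma G_comp: "\<mu> \<in> G k \<Longrightarrow> \<nu> \<in> G k \<Longrightarrow> \<mu> \<circ> \<nu> \<in> G k"
  by (auto simp: G_iff)

lemma G_rot:
  assumes "\<rho> ^ d = 1" "k > 0"
  shows "rot \<rho> \<in> G k"
proof -
  have "g (rot \<rho> x) = g x" for x
    using pw_rot[of d \<rho>] assms(1) by (simp add: g_apply fun_eq_iff)
  moreover have "\<rho> \<noteq> 0"
    using assms(1) d_pos by (rule nonzero_if_power_eq_1)
  ultimately have "rot \<rho> \<in> G 1"
    by (auto simp: G_iff)
  then show ?thesis
    using G_mono[of 1 k] assms(2) by auto
qed

text \<open>Normality: \<open>\<mu>\<close> acts on the values of \<open>g ^^ k\<close> as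
  multiplication by \<open>\<rho>\<close>, and this factor cancels in the conjugate.\<close>

lemma G_conj:
  assumes "\<mu> \<in> G (Suc k)" "\<nu> \<in> G k" "moebius \<mu>'" "\<And>x. \<mu> (\<mu>' x) = x"
  shows "\<mu>' \<circ> \<nu> \<circ> \<mu> \<in> G k"
proof -
  obtain \<rho> where \<rho>: "\<rho> ^ d = 1" "\<And>x. (g ^^ k) (\<mu> x) = rot \<rho> ((g ^^ k) x)"
    using assms(1) by (rule G_SucD) blast
  have "\<rho> \<noteq> 0"
    using \<rho>(1) d_pos by (rule nonzero_if_power_eq_1)
  then have inj: "rot \<rho> x = rot \<rho> y \<Longrightarrow> x = y" for x y
    by (cases x; cases y) auto
  have "(g ^^ k) (\<mu>' (\<nu> (\<mu> x))) = (g ^^ k) x" for x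
  proof (rule inj)
    have "rot \<rho> ((g ^^ k) (\<mu>' (\<nu> (\<mu> x)))) = (g ^^ k) (\<nu> (\<mu> x))"
      by (simp only: \<rho>(2)[symmetric] assms(4))
    also have "\<dots> = (g ^^ k) (\<mu> x)"
      using assms(2) by (simp add: G_iff)
    finally show "rot \<rho> ((g ^^ k) (\<mu>' (\<nu> (\<mu> x)))) = rot \<rho> ((g ^^ k) x)"
      by (simp only: \<rho>(2))
  qed
  then show ?thesis
    using assms by (auto simp: G_iff)
qed

text \<open>Since \<open>g \<circ> \<mu>\<close> equals
  \<open>M \<circ> \<nu> \<circ> M' \<circ> g\<close> and \<open>g\<close> is onto, one application
  of \<open>g\<close> can be cancelled.\<close>

lemma descend:
  assumes "\<mu> \<in> G (Suc k)" "pw d \<circ> \<mu> = \<nu> \<circ> pw d" "moebius \<nu>"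
  shows "M \<circ> \<nu> \<circ> M' \<in> G k"
proof -
  have "(g ^^ k) (M (\<nu> (M' y))) = (g ^^ k) y" for y
  proof -
    obtain x where x: "M' y = pw d x"
      using surj_pw[OF d_pos] by (metis surjD)
    have "(g ^^ k) (M (\<nu> (M' y))) = (g ^^ k) (g (\<mu> x))"
      using assms(2) by (simp add: x g_apply fun_eq_iff)
    also have "\<dots> = (g ^^ k) (g x)"
      using assms(1) by (simp add: G_iff funpow_swap1)
    also have "g x = y"
      by (simp add: g_apply x[symmetric])
    finally show ?thesis .
  qed
  then show ?thesis
    using assms(3) moebius_M moebius_M' by (auto simp: G_iff)
qed

lemma descend_rot: "rot a \<in> G (Suc k) \<Longrightarrow> a \<noteq> 0 \<Longrightarrow> M \<circ> rot (a ^ d) \<circ> M' \<in> G k"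
  by (rule descend[OF _ pw_rot]) auto

lemma descend_flip: "flip a \<in> G (Suc k) \<Longrightarrow> a \<noteq> 0 \<Longrightarrow> M \<circ> flip (a ^ d) \<circ> M' \<in> G k"
  by (rule descend[OF _ pw_flip[OF d_pos]]) auto

text \<open>The stabilizer of {0, infinity} in the Moebius group.\<close>

definition monomial_moebius :: "(sphere \<Rightarrow> sphere) set" where
  "monomial_moebius = {rot a | a. a \<noteq> 0} \<union> {flip a | a. a \<noteq> 0}"

lemma monomial_moebius_iff:
  assumes "moebius \<mu>"
  shows "\<mu> \<in> monomial_moebius \<longleftrightarrow> \<mu> ` {Some 0, None} \<subseteq> {Some 0, None}"
proof
  assume "\<mu> ` {Some 0, None} \<subseteq> {Some 0, None}"
  moreover have "card (\<mu> ` {Some 0, None}) = 2"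
    using bij_moebius[OF assms] by (subst card_image) (auto simp: bij_def inj_on_def)
  ultimately have "\<mu> ` {Some 0, None} = {Some 0, None}"
    by (intro card_subset_eq) auto
  then show "\<mu> \<in> monomial_moebius"
    using moebius_rot_or_flip[OF assms] by (auto simp: monomial_moebius_def)
qed (auto simp: monomial_moebius_def)

text \<open>\<open>\<mu>\<close> carries fixed points of \<open>rot b\<close> to fixed points of
  \<open>rot \<omega>\<close>, and the latter are only 0 and infinity.\<close>

lemma monomial_moebius_if_conj_rot:
  assumes "moebius \<mu>" "\<And>x. \<mu> (\<mu>' x) = x" "\<mu>' \<circ> rot \<omega> \<circ> \<mu> = rot b" "\<omega> \<noteq> 1"
  shows "\<mu> \<in> monomial_moebius"
  unfolding monomial_moebius_iff[OF assms(1)]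
proof (rule image_subsetI)
  fix x :: sphere assume "x \<in> {Some 0, None}"
  then have "rot b x = x"
    by auto
  then have "\<mu>' (rot \<omega> (\<mu> x)) = x"
    using assms(3) by (simp add: fun_eq_iff)
  then have "rot \<omega> (\<mu> x) = \<mu> x"
    using assms(2) by metis
  then show "\<mu> x \<in> {Some 0, None}"
    by (simp only: rot_fixed_iff[OF assms(4)])
qed

end

section \<open>Non-power maps of even degree\<close>

text \<open>\<open>M\<close> sends 0 and infinity to the critical values of \<open>g\<close>, so
  \<open>non_power\<close> says that these are not the two critical points.\<close>

locale non_power_composition = power_composition +
  assumes even_d: "even d" and non_power: "M ` {Some 0, None} \<noteq> {Some 0, None}"
begin

lemma flip_notin_G_1: "flip b \<notin> G (Suc 0)"
proof
  assume "flip b \<in> G (Suc 0)"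
  then obtain \<rho> where "\<And>x. flip b x = rot \<rho> x"
    by (rule G_SucD) simp
  then have "flip b = rot \<rho>"
    by blast
  then show False
    by simp
qed

lemma rot_minus_1_mem: "k > 0 \<Longrightarrow> rot (- 1) \<in> G k"
  using even_d by (intro G_rot) auto

lemma rot_minus_1_fixed: "rot (- 1) x = x \<longleftrightarrow> x \<in> {Some 0, None}"
  by (rule rot_fixed_iff) simp

text \<open>Take the first iterate that has \<open>flip b\<close> as a deck transformation. Under \<open>g\<close> the flip descends
  to a deck transformation of the preceding iterate, and there only the rotation by \<open>-1\<close> is
  left.\<close>

lemma g_flip:
  assumes "d = 2" "G k \<subseteq> monomial_moebius" "\<And>\<omega>. rot \<omega> \<in> G k \<Longrightarrow> \<omega>\<^sup>2 = 1"
    and "flip b \<in> G k" "b \<noteq> 0"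
  shows "g (flip b x) = rot (- 1) (g x)"
proof -
  define a where "a = (LEAST n. flip b \<in> G n)"
  have a: "flip b \<in> G a" "a \<le> k"
    unfolding a_def using assms(4) by (auto intro: LeastI Least_le)
  have "a \<noteq> 0"
    using a(1) G_0 by (metis flip_neq_id singletonD)
  then obtain j where j: "a = Suc j"
    by (metis not0_implies_Suc)
  have no_flip: "flip b \<notin> G j"
    using not_less_Least[of j "\<lambda>n. flip b \<in> G n"] j by (simp add: a_def)
  \<comment> \<open>As \<open>d = 2\<close>, this is the map to which \<open>flip b\<close> descends
    under \<open>g\<close>.\<close>
  let ?\<nu> = "M \<circ> flip (b\<^sup>2) \<circ> M'"
  have \<nu>: "?\<nu> \<in> G j"
    using descend_flip[of b j] a(1) assms(1,5) j by simp
  then have "?\<nu> \<in> G k"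
    using G_mono[of j k] a(2) j by auto
  have \<nu>_ne: "?\<nu> \<noteq> id"
  proof
    assume "?\<nu> = id"
    then have "M' \<circ> ?\<nu> \<circ> M = id"
      by (simp add: M'_M)
    then have "flip (b\<^sup>2) = id"
      by (simp add: fun_eq_iff)
    then show False
      by simp
  qed
  \<comment> \<open>If it were \<open>flip c\<close>, the rotation by \<open>c / b\<close> would
    have square 1, so \<open>c\<close> would be \<open>b\<close> or \<open>- b\<close>. Either way
    \<open>flip b\<close> would lie in \<open>G j\<close>, against minimality.\<close>
  have "\<exists>c. ?\<nu> = rot c"
  proof (rule ccontr)
    assume "\<nexists>c. ?\<nu> = rot c"
    then obtain c where c: "c \<noteq> 0" "?\<nu> = flip c"
      using assms(2) \<open>?\<nu> \<in> G k\<close> unfolding monomial_moebius_def by blast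
    have "flip c \<circ> flip b \<in> G k"
      using \<open>?\<nu> \<in> G k\<close> assms(4) unfolding c(2) by (rule G_comp)
    then have "(c / b)\<^sup>2 = 1"
      using assms(3) flip_flip[OF c(1) assms(5)] by metis
    then have "c\<^sup>2 = b\<^sup>2"
      using assms(5) by (simp add: power_divide)
    then have "c = b \<or> c = - b"
      by (simp add: power2_eq_iff)
    moreover have "c \<noteq> b"
      using \<nu> no_flip unfolding c(2) by blast
    moreover have "c \<noteq> - b"
    proof
      assume "c = - b"
      have "j > 0"
        using \<nu> \<nu>_ne G_0 by (metis not_gr0 singletonD)
      then have "rot (- 1) \<circ> flip c \<in> G j"
        using \<nu> rot_minus_1_mem unfolding c(2) by (intro G_comp)
      then show False
        using no_flip \<open>c = - b\<close> by (simp add: rot_flip)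
    qed
    ultimately show False
      by blast
  qed
  then obtain c where c: "?\<nu> = rot c"
    by blast
  have "c\<^sup>2 = 1" "c \<noteq> 1"
    using assms(3) \<open>?\<nu> \<in> G k\<close> \<nu>_ne unfolding c by auto
  then have "c = - 1"
    by (simp add: power2_eq_1_iff)
  have "g (flip b x) = M (flip (b\<^sup>2) (pw d x))"
  proof -
    have "b ^ d = b\<^sup>2"
      by (simp add: assms(1))
    then show ?thesis
      using fun_cong[OF pw_flip[OF d_pos, of b], of x] by (simp add: g_apply)
  qed
  also have "\<dots> = ?\<nu> (g x)"
    by (simp add: g_apply)
  finally show ?thesis
    unfolding c \<open>c = - 1\<close> .
qed

text \<open>\<open>flip b\<close> exchanges 0 and infinity, so the critical values are negatives of
  each other. Being distinct, neither is fixed by \<open>rot (- 1)\<close>.\<close>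

lemma g_critical_values:
  assumes "\<And>x. g (flip b x) = rot (- 1) (g x)"
  shows "g None = rot (- 1) (g (Some 0))" "x \<in> {Some 0, None} \<Longrightarrow> g x \<notin> {Some 0, None}"
proof -
  show 1: "g None = rot (- 1) (g (Some 0))"
    using assms[of "Some 0"] by simp
  have "g None \<noteq> g (Some 0)"
    using d_pos by (simp add: g_apply)
  moreover have "g (Some 0) = rot (- 1) (g None)"
    using assms[of None] by simp
  ultimately show "g x \<notin> {Some 0, None}" if "x \<in> {Some 0, None}"
    using that 1 rot_minus_1_fixed by (metis insertE singletonD)
qed

text \<open>This is the only way in which a deck group could fail to preserve \<open>{0, \<infinity>}\<close>: the deck
  group of \<open>g\<^sup>k\<close> is a Klein four-group and \<open>\<mu>\<close> exchanges \<open>{0, \<infinity>}\<close> with the fixed points \<open>\<plusminus>\<beta>\<close>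
  of \<open>flip b\<close>. As \<open>g\<^sup>k \<circ> \<mu> = - g\<^sup>k\<close>, the values of \<open>g\<^sup>k\<close> at \<open>0\<close>, \<open>\<beta>\<close> and \<open>\<i>\<beta>\<close> are then related in a
  way that makes a critical value critical.\<close>

lemma klein_four_case:
  assumes "d = 2" "k > 0" "G k \<subseteq> monomial_moebius" "\<And>\<omega>. rot \<omega> \<in> G k \<Longrightarrow> \<omega>\<^sup>2 = 1"
    and "flip b \<in> G k" "b \<noteq> 0"
    and "\<mu> \<in> G (Suc k)" "\<And>x. \<mu> (\<mu>' x) = x" "\<And>x. \<mu>' (\<mu> x) = x"
    and "\<mu>' \<circ> rot (- 1) \<circ> \<mu> = flip b"
  shows False
proof -
  note gf = g_flip[OF assms(1,3-6)]
  note cv = g_critical_values[OF gf]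
  have gm: "g (rot (- 1) x) = g x" for x
    using rot_minus_1_mem[of 1] by (simp add: G_iff)
  have Gm: "(g ^^ k) (rot (- 1) x) = (g ^^ k) x" for x
    using rot_minus_1_mem[OF assms(2)] by (simp add: G_iff)
  define \<beta> where "\<beta> = csqrt b"
  have \<beta>: "\<beta>\<^sup>2 = b" "\<beta> \<noteq> 0"
    using assms(6) by (auto simp: \<beta>_def)
  have flip\<beta>: "flip b (Some \<beta>) = Some \<beta>"
    using \<beta> by (simp add: power2_eq_square field_simps)
  have flip\<i>: "flip b (Some (\<i> * \<beta>)) = rot (- 1) (Some (\<i> * \<beta>))"
    using \<beta> by (simp add: power2_eq_square field_simps)
  \<comment> \<open>\<open>flip b\<close> fixes \<open>\<beta>\<close> and negates
    \<open>\<i> * \<beta>\<close>, while \<open>g\<close> is even. By \<open>gf\<close> both values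
    equal their own negatives, hence lie in {0, infinity}.\<close>
  define p q where "p = g (Some \<beta>)" and "q = g (Some (\<i> * \<beta>))"
  have p: "p \<in> {Some 0, None}"
    using gf[of "Some \<beta>"] rot_minus_1_fixed unfolding p_def flip\<beta> by metis
  have q: "q \<in> {Some 0, None}"
    using gf[of "Some (\<i> * \<beta>)"] rot_minus_1_fixed unfolding q_def flip\<i> gm by metis
  have "pw d (Some z) = Some (z\<^sup>2)" for z
    by (simp add: assms(1))
  then have "p \<noteq> q"
    using \<beta> assms(6) by (simp add: p_def q_def g_apply power_mult_distrib del: pw_simps)
  obtain \<rho> where \<rho>: "\<rho> ^ d = 1" "\<And>x. (g ^^ k) (\<mu> x) = rot \<rho> ((g ^^ k) x)"
    using assms(7) by (rule G_SucD) blast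
  have mu: "moebius \<mu>"
    using assms(7) by (simp add: G_iff)
  have conj: "\<mu>' (rot (- 1) (\<mu> x)) = flip b x" for x
    using assms(10) by (simp add: fun_eq_iff)
  \<comment> \<open>Otherwise \<open>\<mu>\<close> would send infinity to a fixed point of
    \<open>rot (- 1)\<close>, and the conjugate \<open>flip b\<close> would fix infinity.\<close>
  have "\<mu> \<notin> monomial_moebius"
  proof
    assume "\<mu> \<in> monomial_moebius"
    then have "\<mu> None \<in> {Some 0, None}"
      using monomial_moebius_iff[OF mu] by auto
    then have "rot (- 1) (\<mu> None) = \<mu> None"
      by (simp only: rot_minus_1_fixed)
    then have "flip b None = None"
      using conj[of None] assms(9) by simp
    then show False
      by simp
  qed
  then have "\<mu> \<notin> G k"
    using assms(3) by blast
  then have "\<rho> \<noteq> 1"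
    using \<rho>(2) mu by (auto simp: G_iff)
  then have "\<rho> = - 1"
    using \<rho>(1) assms(1) by (simp add: power2_eq_1_iff)
  with \<rho>(2) have eq: "(g ^^ k) (\<mu> x) = rot (- 1) ((g ^^ k) x)" for x
    by simp
  \<comment> \<open>Conjugation takes the fixed point \<open>\<beta>\<close> of
    \<open>flip b\<close> to a fixed point of \<open>rot (- 1)\<close>; \<open>g ^^ k\<close> has
    the same value at both of these.\<close>
  have "rot (- 1) (\<mu> (Some \<beta>)) = \<mu> (Some \<beta>)"
    using conj[of "Some \<beta>"] assms(8) unfolding flip\<beta> by metis
  then have "\<mu> (Some \<beta>) \<in> {Some 0, None}"
    by (simp only: rot_minus_1_fixed)
  moreover have A: "(g ^^ k) None = (g ^^ k) (Some 0)"
    using assms(5) by (metis G_iff flip_simps(1))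
  ultimately have AB: "(g ^^ k) (Some 0) = rot (- 1) ((g ^^ k) (Some \<beta>))"
    using eq[of "Some \<beta>"] by auto
  \<comment> \<open>The square of \<open>\<mu>\<close> is monomial and commutes with
    \<open>rot (- 1)\<close>, so conjugation by \<open>\<mu>\<close> also turns
    \<open>flip b\<close> back into \<open>rot (- 1)\<close>.\<close>
  have "\<mu> \<circ> \<mu> \<in> G k"
  proof -
    have "(g ^^ k) (\<mu> (\<mu> x)) = (g ^^ k) x" for x
      unfolding eq using rot_rot[of "- 1" "- 1"] by (simp add: fun_eq_iff)
    then show ?thesis
      using mu by (auto simp: G_iff)
  qed
  then have "\<mu> \<circ> \<mu> \<in> monomial_moebius"
    using assms(3) by blast
  then have "rot (- 1) \<circ> (\<mu> \<circ> \<mu>) = (\<mu> \<circ> \<mu>) \<circ> rot (- 1)"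
    unfolding monomial_moebius_def by (auto simp: rot_rot rot_flip flip_rot)
  then have comm: "rot (- 1) (\<mu> (\<mu> x)) = \<mu> (\<mu> (rot (- 1) x))" for x
    by (simp add: fun_eq_iff)
  have conj2: "\<mu>' (flip b (\<mu> x)) = rot (- 1) x" for x
    by (simp only: conj[symmetric] comm assms(9))
  have conj3: "\<mu>' (rot (- 1) (flip b (\<mu> x))) = flip b (rot (- 1) x)" for x
    using conj[of "\<mu>' (flip b (\<mu> x))"] unfolding assms(8) unfolding conj2 .
  \<comment> \<open>\<open>\<i> * \<beta>\<close> is fixed by
    \<open>flip b \<circ> rot (- 1)\<close>, so \<open>y\<close> is fixed by
    \<open>rot (- 1) \<circ> flip b\<close> and is itself plus or minus
    \<open>\<i> * \<beta>\<close>. Hence \<open>g ^^ k\<close> equals its own negative at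
    \<open>\<i> * \<beta>\<close>.\<close>
  define y where "y = \<mu> (Some (\<i> * \<beta>))"
  have "flip b (rot (- 1) (Some (\<i> * \<beta>))) = Some (\<i> * \<beta>)"
    using \<beta>(2) by (simp add: \<beta>(1)[symmetric] power2_eq_square field_simps)
  then have "rot (- 1) (flip b y) = y"
    using conj3[of "Some (\<i> * \<beta>)"] assms(8) unfolding y_def by metis
  then obtain z where z: "y = Some z" "z \<noteq> 0" "- (b / z) = z"
    by (cases y rule: sphere_cases) auto
  then have "z\<^sup>2 = (\<i> * \<beta>)\<^sup>2"
    using \<beta>(1) by (simp add: power2_eq_square field_simps)
  then have "y = Some (\<i> * \<beta>) \<or> y = rot (- 1) (Some (\<i> * \<beta>))"
    using z(1) by (auto simp: power2_eq_iff)
  then have "(g ^^ k) y = (g ^^ k) (Some (\<i> * \<beta>))"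
    using Gm by metis
  then have C: "(g ^^ k) (Some (\<i> * \<beta>)) \<in> {Some 0, None}"
    using eq[of "Some (\<i> * \<beta>)"] rot_minus_1_fixed unfolding y_def by metis
  have "k \<noteq> 1"
    using assms(5) flip_notin_G_1 by auto
  then obtain j where k: "k = Suc (Suc j)"
    using assms(2) by (metis One_nat_def gr0_implies_Suc not0_implies_Suc)
  have it: "(g ^^ k) x = (g ^^ Suc j) (g x)" for x
    unfolding k by (simp add: funpow_swap1)
  have pq: "p = Some 0 \<and> q = None \<or> p = None \<and> q = Some 0"
    using p q \<open>p \<noteq> q\<close> by auto
  show False
  proof (cases j)
    case 0
    \<comment> \<open>Here \<open>k = 2\<close>, and \<open>g q\<close> is a critical value because
      \<open>q\<close> is 0 or infinity.\<close>
    then have "g q \<in> {Some 0, None}"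
      using C unfolding it by (simp add: q_def)
    then show False
      using cv(2) q by blast
  next
    case (Suc i)
    \<comment> \<open>\<open>rot (- 1)\<close> lies in \<open>G j\<close> for positive
      \<open>j\<close>, so the two opposite critical values have the same image under
      \<open>g ^^ j\<close>. Then \<open>g ^^ Suc j\<close> takes one value \<open>B\<close> at 0,
      infinity, \<open>p\<close> and \<open>q\<close>, and \<open>AB\<close> yields
      \<open>g B = B\<close>: a critical point would be a critical value.\<close>
    have "(g ^^ Suc j) None = (g ^^ j) (g None)"
      by (simp add: funpow_swap1)
    also have "\<dots> = (g ^^ j) (g (Some 0))"
      using rot_minus_1_mem[of j] Suc cv(1) by (metis G_iff zero_less_Suc)
    also have "\<dots> = (g ^^ Suc j) (Some 0)"
      by (simp add: funpow_swap1)
    finally have "(g ^^ Suc j) p = (g ^^ Suc j) q" "(g ^^ Suc j) (Some 0) = (g ^^ Suc j) q"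
      using pq by auto
    moreover define B where "B = (g ^^ Suc j) q"
    ultimately have B: "(g ^^ k) (Some \<beta>) = B" "(g ^^ Suc j) (Some 0) = B" "B \<in> {Some 0, None}"
      using C unfolding it p_def q_def by simp_all
    have "(g ^^ k) (Some 0) = g B"
      unfolding k B(2)[symmetric] by simp
    moreover have "(g ^^ k) (Some 0) = B"
      unfolding AB B(1) using B(3) by (simp only: rot_minus_1_fixed)
    ultimately show False
      using cv(2) B(3) by metis
  qed
qed

text \<open>Conjugates of rotations in \<open>G k\<close> are rotations or flips. A rotation of
  order above 2 cannot become a flip, as flips are involutions; if there is none, then
  \<open>d = 2\<close> and \<open>klein_four_case\<close> applies.\<close>

lemma G_Suc_subset:
  assumes "k > 0" "G k \<subseteq> monomial_moebius"
  shows "G (Suc k) \<subseteq> monomial_moebius"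
proof
  fix \<mu> assume \<mu>: "\<mu> \<in> G (Suc k)"
  then have mu: "moebius \<mu>"
    by (simp add: G_iff)
  obtain \<mu>' where \<mu>': "moebius \<mu>'" "\<mu>' \<circ> \<mu> = id" "\<mu> \<circ> \<mu>' = id"
    using mu by (rule moebius_inverse)
  then have inv: "\<mu>' (\<mu> x) = x" "\<mu> (\<mu>' x) = x" for x
    by (simp_all add: fun_eq_iff)
  have conj: "\<mu>' \<circ> rot \<omega> \<circ> \<mu> \<in> monomial_moebius" if "rot \<omega> \<in> G k" for \<omega>
    using G_conj[OF \<mu> that \<mu>'(1) inv(2)] assms(2) by blast
  show "\<mu> \<in> monomial_moebius"
  proof (cases "\<exists>\<omega>. rot \<omega> \<in> G k \<and> \<omega>\<^sup>2 \<noteq> 1")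
    case True
    then obtain \<omega> where \<omega>: "rot \<omega> \<in> G k" "\<omega>\<^sup>2 \<noteq> 1"
      by blast
    have "\<mu>' \<circ> rot \<omega> \<circ> \<mu> \<noteq> flip b" if "b \<noteq> 0" for b
    proof
      assume eq: "\<mu>' \<circ> rot \<omega> \<circ> \<mu> = flip b"
      have "flip b \<circ> flip b = id"
        using that by (simp add: flip_flip)
      then have "\<mu>' (rot \<omega> (rot \<omega> (\<mu> x))) = x" for x
        unfolding eq[symmetric] by (simp add: fun_eq_iff inv)
      then have "rot \<omega> (rot \<omega> (\<mu> x)) = \<mu> x" for x
        using inv by metis
      then have "rot \<omega> (rot \<omega> y) = y" for y
        using inv by metis
      then have "rot (\<omega>\<^sup>2) = id"
        unfolding power2_eq_square rot_rot[symmetric] by (simp add: fun_eq_iff)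
      then show False
        using \<omega>(2) by simp
    qed
    then obtain b where "\<mu>' \<circ> rot \<omega> \<circ> \<mu> = rot b"
      using conj[OF \<omega>(1)] unfolding monomial_moebius_def by blast
    moreover have "\<omega> \<noteq> 1"
      using \<omega>(2) by auto
    ultimately show ?thesis
      using monomial_moebius_if_conj_rot[OF mu inv(2)] by blast
  next
    case False
    then have sq: "\<omega>\<^sup>2 = 1" if "rot \<omega> \<in> G k" for \<omega>
      using that by blast
    \<comment> \<open>All \<open>d\<close>-th roots of unity give rotations in \<open>G k\<close>;
      that they square to 1 bounds \<open>d\<close> by 2.\<close>
    have "{z::complex. z ^ d = 1} \<subseteq> {z. z ^ 2 = 1}"
      using sq G_rot[OF _ assms(1)] by auto
    then have "card {z::complex. z ^ d = 1} \<le> card {z::complex. z ^ 2 = 1}"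
      using card_roots_of_unity[of 2] by (intro card_mono) auto
    then have "d \<le> 2"
      using card_roots_of_unity[of 2] card_roots_of_unity[OF d_pos] by simp
    then have d: "d = 2"
      using d_pos even_d by (auto elim: evenE)
    have m1: "rot (- 1) \<in> G k"
      using assms(1) by (rule rot_minus_1_mem)
    show ?thesis
    proof (cases "\<exists>b. \<mu>' \<circ> rot (- 1) \<circ> \<mu> = rot b")
      case True
      then show ?thesis
        using monomial_moebius_if_conj_rot[OF mu inv(2)] by fastforce
    next
      case no_rot: False
      then obtain b where b: "b \<noteq> 0" "\<mu>' \<circ> rot (- 1) \<circ> \<mu> = flip b"
        using conj[OF m1] unfolding monomial_moebius_def by blast
      have "flip b \<in> G k"
        using G_conj[OF \<mu> m1 \<mu>'(1) inv(2)] b(2) by simp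
      from klein_four_case[OF d assms(1,2) sq this b(1) \<mu> inv(2,1) b(2)] show ?thesis
        by simp
    qed
  qed
qed

lemma G_subset: "G k \<subseteq> monomial_moebius"
proof (induction k)
  case 0
  show ?case
    using rot_one by (auto simp: G_0 monomial_moebius_def intro!: exI[of _ 1])
next
  case (Suc k)
  show ?case
  proof (cases "k = 0")
    \<comment> \<open>\<open>G 0\<close> contains no nontrivial rotation, so the inductive step only
      starts at \<open>G 1\<close>, found directly from \<open>G_SucD\<close>.\<close>
    case True
    show ?thesis
    proof
      fix \<mu> assume \<mu>: "\<mu> \<in> G (Suc k)"
      then obtain \<rho> where \<rho>: "\<rho> ^ d = 1" "\<And>x. \<mu> x = rot \<rho> x"
        unfolding True by (rule G_SucD) simp
      then have "\<mu> = rot \<rho>"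
        by blast
      then show "\<mu> \<in> monomial_moebius"
        using nonzero_if_power_eq_1[OF \<rho>(1) d_pos] by (auto simp: monomial_moebius_def)
    qed
  qed (use Suc G_Suc_subset in blast)
qed

text \<open>The second alternative records a flip, so that a cyclic group of order
  \<open>2 * d\<close> cannot occur: the descended map is itself that flip.\<close>

lemma rot_mem_G_cases:
  assumes "rot a \<in> G (Suc k)" "a \<noteq> 0"
  shows "a ^ d = 1 \<or> a ^ d = - 1 \<and> (\<exists>b. b \<noteq> 0 \<and> flip b \<in> G (Suc k))"
proof -
  let ?\<nu> = "M \<circ> rot (a ^ d) \<circ> M'"
  have \<nu>: "?\<nu> \<in> G k"
    using assms by (rule descend_rot)
  then consider c where "?\<nu> = rot c" | c where "?\<nu> = flip c" "c \<noteq> 0"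
    using G_subset unfolding monomial_moebius_def by blast
  then show ?thesis
  proof cases
    case 1
    \<comment> \<open>A nontrivial rotation fixing the images of 0 and infinity under
      \<open>M\<close> would make \<open>M\<close> preserve {0, infinity}.\<close>
    have "c = 1"
    proof (rule ccontr)
      assume "c \<noteq> 1"
      have "rot c (M x) = M x" if "x \<in> {Some 0, None}" for x
        unfolding 1[symmetric] using that by auto
      then have "M ` {Some 0, None} \<subseteq> {Some 0, None}"
        using rot_fixed_iff[OF \<open>c \<noteq> 1\<close>] by (metis image_subsetI)
      then have "M \<in> monomial_moebius"
        using monomial_moebius_iff[OF moebius_M] by simp
      then show False
        using non_power by (auto simp: monomial_moebius_def)
    qed
    then have "M (rot (a ^ d) (M' (M x))) = M x" for x
      using fun_cong[OF 1, of "M x"] by simp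
    then have "rot (a ^ d) = id"
      by (simp add: fun_eq_iff)
    then show ?thesis
      by simp
  next
    case 2
    have "flip c \<circ> flip c = id"
      using 2(2) by (simp add: flip_flip)
    then have "M (rot (a ^ d) (rot (a ^ d) (M' y))) = y" for y
      unfolding 2(1)[symmetric] by (simp add: fun_eq_iff)
    from this[of "M (Some 1)"] have "(a ^ d) * (a ^ d) = 1"
      by simp
    then have "a ^ d = 1 \<or> a ^ d = - 1"
      by (metis power2_eq_1_iff power2_eq_square)
    moreover have "flip c \<in> G (Suc k)"
      using \<nu> G_mono[of k "Suc k"] unfolding 2(1) by auto
    ultimately show ?thesis
      using 2(2) by blast
  qed
qed

lemma G_classification:
  assumes "k > 0"
  shows "G k = rot ` {a. a ^ d = 1} \<or>
    (\<exists>b n. b \<noteq> 0 \<and> n \<in> {d, 2 * d} \<and>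
      G k = rot ` {a. a ^ n = 1} \<union> (\<lambda>a. flip (a * b)) ` {a. a ^ n = 1})"
proof -
  obtain k' where k: "k = Suc k'"
    using assms by (metis gr0_implies_Suc)
  have nz: "a \<noteq> 0" if "rot a \<in> G k" for a
  proof
    assume "a = 0"
    then have "moebius (rot 0)"
      using that by (simp add: G_iff)
    then have "inj (rot 0)"
      by (metis bij_moebius bij_is_inj)
    then show False
      by (metis injD mult_zero_left option.inject rot_simps(2) zero_neq_one)
  qed
  note rots = rot_mem_G_cases[of _ k', folded k]
  show ?thesis
  proof (cases "\<exists>b. b \<noteq> 0 \<and> flip b \<in> G k")
    case False
    have "G k \<subseteq> rot ` {a. a ^ d = 1}"
    proof
      fix \<mu> assume \<mu>: "\<mu> \<in> G k"
      with False obtain a where a: "\<mu> = rot a" "a \<noteq> 0"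
        using G_subset[of k] unfolding monomial_moebius_def by blast
      have "rot a \<in> G k"
        using \<mu> a(1) by simp
      from rots[OF this a(2)] False have "a ^ d = 1"
        by blast
      then show "\<mu> \<in> rot ` {a. a ^ d = 1}"
        using a(1) by blast
    qed
    moreover have "rot ` {a. a ^ d = 1} \<subseteq> G k"
      using G_rot[OF _ assms] by blast
    ultimately show ?thesis
      by blast
  next
    case True
    then obtain b where b: "b \<noteq> 0" "flip b \<in> G k"
      by blast
    \<comment> \<open>Two solutions of \<open>a ^ d = - 1\<close> differ by a \<open>d\<close>-th
      root of unity, so a single one enlarges the rotations to all \<open>2 * d\<close>-th
      roots.\<close>
    obtain n where n: "n \<in> {d, 2 * d}" "\<And>a. rot a \<in> G k \<longleftrightarrow> a ^ n = 1"
    proof (cases "\<forall>a. rot a \<in> G k \<longrightarrow> a ^ d = 1")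
      case True
      then show ?thesis
        using that[of d] G_rot[OF _ assms] by blast
    next
      case False
      then obtain a where a: "rot a \<in> G k" "a ^ d = - 1" "a \<noteq> 0"
        using rots nz by blast
      have "rot x \<in> G k \<longleftrightarrow> x ^ (2 * d) = 1" for x
      proof
        assume "rot x \<in> G k"
        then have "x ^ d = 1 \<or> x ^ d = - 1"
          using rots nz by blast
        then show "x ^ (2 * d) = 1"
          by (auto simp: mult.commute[of 2] power_mult)
      next
        assume "x ^ (2 * d) = 1"
        then have "(x ^ d)\<^sup>2 = 1"
          by (simp add: mult.commute[of 2] power_mult)
        then have "x ^ d = 1 \<or> x ^ d = - 1"
          by (simp add: power2_eq_1_iff)
        then show "rot x \<in> G k"
        proof
          assume "x ^ d = - 1"
          then have "(x / a) ^ d = 1"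
            using a by (simp add: power_divide)
          then have "rot (x / a) \<circ> rot a \<in> G k"
            using a(1) G_rot[OF _ assms] G_comp by blast
          then show ?thesis
            using a(3) by (simp add: rot_rot)
        qed (rule G_rot[OF _ assms])
      qed
      then show ?thesis
        using that[of "2 * d"] by blast
    qed
    have "G k = rot ` {a. a ^ n = 1} \<union> (\<lambda>a. flip (a * b)) ` {a. a ^ n = 1}"
    proof
      show "G k \<subseteq> rot ` {a. a ^ n = 1} \<union> (\<lambda>a. flip (a * b)) ` {a. a ^ n = 1}"
      proof
        fix \<mu> assume \<mu>: "\<mu> \<in> G k"
        then consider a where "\<mu> = rot a" | c where "\<mu> = flip c" "c \<noteq> 0"
          using G_subset[of k] unfolding monomial_moebius_def by blast
        then show "\<mu> \<in> rot ` {a. a ^ n = 1} \<union> (\<lambda>a. flip (a * b)) ` {a. a ^ n = 1}"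
        proof cases
          case 2
          \<comment> \<open>All flips lie in one coset of the rotations.\<close>
          then have "rot (c / b) \<in> G k"
            using G_comp[OF \<mu> b(2)] b(1) by (simp add: flip_flip)
          then have "(c / b) ^ n = 1"
            using n(2) by blast
          moreover have "\<mu> = flip (c / b * b)"
            using 2 b(1) by simp
          ultimately show ?thesis
            by blast
        qed (use \<mu> n(2) in blast)
      qed
      have "flip (a * b) \<in> G k" if "a ^ n = 1" for a
        using G_comp[OF _ b(2)] n(2) that rot_flip by metis
      then show "rot ` {a. a ^ n = 1} \<union> (\<lambda>a. flip (a * b)) ` {a. a ^ n = 1} \<subseteq> G k"
        using n(2) by blast
    qed
    then show ?thesis
      using b(1) n(1) by blast
  qed
qed

end

section \<open>Isomorphism types of the deck groups\<close>

lemma Deck_rotations: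
  assumes "carrier (Deck F) = rot ` {a. a ^ n = 1}" "n > 0"
  shows "Deck F \<cong> integer_mod_group n"
    and "finite (carrier (Deck F))" "card (carrier (Deck F)) = n"
proof -
  interpret group "Deck F"
    by (rule group_Deck)
  show "finite (carrier (Deck F))"
    using card_roots_of_unity[OF assms(2)] by (simp add: assms(1))
  show card: "card (carrier (Deck F)) = n"
    using card_roots_of_unity[OF assms(2)] by (simp add: assms(1) card_image inj_on_def)
  obtain \<omega> :: complex where \<omega>: "\<omega> ^ n = 1" "{z. z ^ n = 1} = range (\<lambda>i. \<omega> ^ i)"
    using assms(2) by (rule roots_of_unity_generator)
  have pow: "rot \<omega> [^]\<^bsub>Deck F\<^esub> i = rot (\<omega> ^ i)" for i :: nat
    by (induction i) (simp_all add: rot_rot mult.commute)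
  show "Deck F \<cong> integer_mod_group n"
  proof (rule iso_integer_mod_groupI[OF _ _ assms(2) _ card])
    show "rot \<omega> \<in> carrier (Deck F)"
      unfolding assms(1) using \<omega>(1) by blast
    show "carrier (Deck F) \<subseteq> range (\<lambda>i::nat. rot \<omega> [^]\<^bsub>Deck F\<^esub> i)"
      unfolding assms(1) \<omega>(2) pow by blast
  qed (simp add: pow \<omega>(1))
qed

lemma Deck_rotations_flips:
  assumes "carrier (Deck F) = rot ` {a. a ^ n = 1} \<union> (\<lambda>a. flip (a * b)) ` {a. a ^ n = 1}"
    and "n > 0" "b \<noteq> 0"
  shows "Deck F \<cong> dihedral_group n"
    and "finite (carrier (Deck F))" "card (carrier (Deck F)) = 2 * n"
proof -
  interpret group "Deck F"
    by (rule group_Deck)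
  note roots = card_roots_of_unity[OF assms(2)]
  show "finite (carrier (Deck F))"
    using roots by (simp add: assms(1))
  have "card (carrier (Deck F)) = card (rot ` {a. a ^ n = 1}) + card ((\<lambda>a. flip (a * b)) ` {a. a ^ n = 1})"
    unfolding assms(1) using roots by (intro card_Un_disjoint) auto
  also have "\<dots> = n + n"
    using roots assms(3) by (simp add: card_image inj_on_def)
  finally show card: "card (carrier (Deck F)) = 2 * n"
    by simp
  obtain \<omega> :: complex where \<omega>: "\<omega> ^ n = 1" "{z. z ^ n = 1} = range (\<lambda>i. \<omega> ^ i)"
    using assms(2) by (rule roots_of_unity_generator)
  have pow: "rot \<omega> [^]\<^bsub>Deck F\<^esub> i = rot (\<omega> ^ i)" for i :: nat
    by (induction i) (simp_all add: rot_rot mult.commute)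
  have "\<omega> \<noteq> 0"
    using \<omega>(1) assms(2) by (rule nonzero_if_power_eq_1)
  show "Deck F \<cong> dihedral_group n"
  proof (rule iso_dihedral_groupI[OF _ _ _ _ _ assms(2) _ card])
    show "rot \<omega> \<in> carrier (Deck F)"
      unfolding assms(1) using \<omega>(1) by blast
    have "flip (1 * b) \<in> carrier (Deck F)"
      unfolding assms(1) by (intro UnI2 imageI) simp
    then show "flip b \<in> carrier (Deck F)"
      by simp
    show "carrier (Deck F) \<subseteq> range (\<lambda>i::nat. rot \<omega> [^]\<^bsub>Deck F\<^esub> i) \<union>
        range (\<lambda>i::nat. rot \<omega> [^]\<^bsub>Deck F\<^esub> i \<otimes>\<^bsub>Deck F\<^esub> flip b)"
      unfolding assms(1) \<omega>(2) pow mult_Deck rot_flip by blast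
  qed (use assms(3) \<open>\<omega> \<noteq> 0\<close> in \<open>simp_all add: pow \<omega>(1) flip_flip rot_flip flip_rot\<close>)
qed

lemma (in power_composition) carrier_Deck_iterate: "carrier (Deck (g ^^ k)) = G k"
  by (simp add: carrier_Deck G_def)

section \<open>Power maps\<close>

text \<open>Rotations and flips pass through \<open>pw d\<close> to rotations and flips, so all of
  them collect on the left and the powers multiply.\<close>

lemma (in power_composition) power_iterate:
  assumes "M ` {Some 0, None} = {Some 0, None}"
  shows "\<exists>K \<in> monomial_moebius. g ^^ k = K \<circ> pw (d ^ k)"
proof (induction k)
  case 0
  have "id \<in> monomial_moebius"
    using monomial_moebius_iff[of id] by auto
  then show ?case
    by (intro bexI[of _ id]) auto
next
  case (Suc k)
  then obtain K where K: "K \<in> monomial_moebius" "g ^^ k = K \<circ> pw (d ^ k)"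
    by blast
  obtain K' where K': "K' \<in> monomial_moebius" "pw d \<circ> K = K' \<circ> pw d"
  proof -
    from K(1) consider c where "K = rot c" "c \<noteq> 0" | c where "K = flip c" "c \<noteq> 0"
      unfolding monomial_moebius_def by blast
    then show ?thesis
    proof cases
      case 1
      then show ?thesis
        using that[of "rot (c ^ d)"] pw_rot by (auto simp: monomial_moebius_def)
    next
      case 2
      then show ?thesis
        using that[of "flip (c ^ d)"] pw_flip[OF d_pos] by (auto simp: monomial_moebius_def)
    qed
  qed
  have "moebius K'"
    using K'(1) by (auto simp: monomial_moebius_def)
  then have "K' ` {Some 0, None} \<subseteq> {Some 0, None}"
    using monomial_moebius_iff[of K'] K'(1) by simp
  then have "M ` K' ` {Some 0, None} \<subseteq> {Some 0, None}"
    using assms by (metis image_mono)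
  moreover have "moebius (M \<circ> K')"
    using moebius_M \<open>moebius K'\<close> by (rule moebius_comp)
  ultimately have "M \<circ> K' \<in> monomial_moebius"
    using monomial_moebius_iff[of "M \<circ> K'"] by (simp only: image_comp)
  moreover have "g ^^ Suc k = M \<circ> (pw d \<circ> K) \<circ> pw (d ^ k)"
    unfolding funpow.simps K(2) unfolding g_def by (simp only: o_assoc)
  then have "g ^^ Suc k = M \<circ> K' \<circ> pw (d ^ Suc k)"
    unfolding K'(2) by (simp add: pw_pw comp_assoc)
  ultimately show ?case
    by blast
qed

lemma Deck_moebius_pw:
  assumes "moebius K" "n > 0"
  shows "carrier (Deck (K \<circ> pw n)) = rot ` {a. a ^ n = 1}"
proof
  have inj: "inj K"
    using bij_moebius[OF assms(1)] by (rule bij_is_inj)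
  show "carrier (Deck (K \<circ> pw n)) \<subseteq> rot ` {a. a ^ n = 1}"
  proof
    fix \<mu> assume "\<mu> \<in> carrier (Deck (K \<circ> pw n))"
    then have \<mu>: "moebius \<mu>" "K (pw n (\<mu> x)) = K (pw n x)" for x
      by (auto simp: carrier_Deck fun_eq_iff)
    then have "pw n \<circ> \<mu> = pw n \<circ> id"
      using inj by (auto simp: fun_eq_iff dest: injD)
    then obtain \<rho> where "\<rho> ^ n = 1" "\<mu> = rot \<rho> \<circ> id"
      using pw_comp_eq_imp_rot[OF assms(2)] rational_map_moebius \<mu>(1) moebius_id by blast
    then show "\<mu> \<in> rot ` {a. a ^ n = 1}"
      by simp
  qed
  show "rot ` {a. a ^ n = 1} \<subseteq> carrier (Deck (K \<circ> pw n))"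
  proof clarify
    fix a :: complex assume a: "a ^ n = 1"
    then have "moebius (rot a)"
      using nonzero_if_power_eq_1 assms(2) by blast
    moreover have "K \<circ> pw n \<circ> rot a = K \<circ> pw n"
      by (simp add: comp_assoc pw_rot a)
    ultimately show "rot a \<in> carrier (Deck (K \<circ> pw n))"
      by (simp add: carrier_Deck)
  qed
qed

section \<open>Transfer to the given map by conjugation\<close>

lemma funpow_conj:
  assumes "N \<circ> N' = id" "N' \<circ> N = id"
  shows "(N' \<circ> h \<circ> N) ^^ k = N' \<circ> (h ^^ k) \<circ> N"
proof (induction k)
  case (Suc k)
  have "N (N' x) = x" for x
    using assms(1) by (metis comp_apply id_apply)
  then show ?case
    using Suc by (auto simp: fun_eq_iff)
qed (simp add: assms)

theorem theorem2:
  fixes f :: "sphere \<Rightarrow> sphere" and d :: nat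
  assumes "bicritical f" and "rat_degree f = d" and "even d"
  shows "(\<forall>k\<ge>1. Deck (f ^^ k) \<cong> dihedral_group d
            \<or> Deck (f ^^ k) \<cong> dihedral_group (2 * d)
            \<or> (\<exists>n\<ge>1. Deck (f ^^ k) \<cong> integer_mod_group (d ^ n)))
       \<and> (\<not> power_map f \<longrightarrow>
           (\<forall>k\<ge>1. finite (carrier (Deck (f ^^ k))) \<and> card (carrier (Deck (f ^^ k))) \<le> 4 * d))"
proof -
  obtain M0 N a b where d: "d > 0" and M0: "moebius M0" and N: "moebius N"
    and f: "f = M0 \<circ> pw d \<circ> N" and crit: "critical_points f = {a, b}"
    and ab: "N a = Some 0" "N b = None"
    using assms(1,2) by (rule bicritical_factorization)
  obtain N' where N': "moebius N'" "N' \<circ> N = id" "N \<circ> N' = id"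
    using N by (rule moebius_inverse)
  define M where "M = N \<circ> M0"
  have M: "moebius M"
    using M0 N by (auto simp: M_def)
  then obtain M' where M': "moebius M'" "M' \<circ> M = id" "M \<circ> M' = id"
    by (rule moebius_inverse)
  interpret power_composition M M' d
    using M M' d by unfold_locales
  have "f = (N' \<circ> N) \<circ> M0 \<circ> pw d \<circ> N"
    by (simp add: f N'(2))
  then have "f = N' \<circ> (N \<circ> M0 \<circ> pw d) \<circ> N"
    by (simp only: comp_assoc)
  then have "f = N' \<circ> g \<circ> N"
    unfolding g_def unfolding M_def .
  then have fk: "f ^^ k = N' \<circ> (g ^^ k) \<circ> N" for k
    using funpow_conj[OF N'(3,2)] by simp
  have iso: "Deck (f ^^ k) \<cong> Deck (g ^^ k)" for k
    unfolding fk using N N' by (intro Deck_conj_iso)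
  \<comment> \<open>\<open>N\<close> carries critical points to {0, infinity} and critical values to
    their image under \<open>M\<close>, so being a power map becomes a condition on
    \<open>M\<close>.\<close>
  have "f a = M0 (Some 0)" "f b = M0 None"
    using ab d by (simp_all add: f power_0_left)
  then have "M ` {Some 0, None} = N ` critical_values f"
    by (simp add: critical_values_def crit M_def)
  moreover have "{Some 0, None} = N ` critical_points f"
    using ab by (simp add: crit)
  moreover have "inj N"
    using bij_moebius[OF N] by (rule bij_is_inj)
  ultimately have power: "power_map f \<longleftrightarrow> M ` {Some 0, None} = {Some 0, None}"
    using assms(1) by (metis inj_image_eq_iff power_map_def)
  show ?thesis
  proof (cases "power_map f")
    case True
    have "Deck (f ^^ k) \<cong> integer_mod_group (d ^ k)" for k
    proof -
      obtain K where K: "K \<in> monomial_moebius" "g ^^ k = K \<circ> pw (d ^ k)"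
        using True power power_iterate by blast
      have "moebius K"
        using K(1) by (auto simp: monomial_moebius_def)
      then have "Deck (g ^^ k) \<cong> integer_mod_group (d ^ k)"
        unfolding K(2) using d by (intro Deck_rotations Deck_moebius_pw) auto
      with iso show ?thesis
        by (rule iso_trans)
    qed
    with True show ?thesis
      by blast
  next
    case False
    then interpret non_power_composition M M' d
      using assms(3) power by unfold_locales auto
    have main: "(Deck (f ^^ k) \<cong> dihedral_group d \<or> Deck (f ^^ k) \<cong> dihedral_group (2 * d)
        \<or> Deck (f ^^ k) \<cong> integer_mod_group (d ^ 1)) \<and>
      finite (carrier (Deck (f ^^ k))) \<and> card (carrier (Deck (f ^^ k))) \<le> 4 * d" if "k \<ge> 1" for k
    proof -
      obtain h where "h \<in> iso (Deck (f ^^ k)) (Deck (g ^^ k))"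
        using iso[of k] unfolding is_iso_def by blast
      then have bij: "bij_betw h (carrier (Deck (f ^^ k))) (carrier (Deck (g ^^ k)))"
        by (simp add: iso_def)
      have "k > 0"
        using that by simp
      from G_classification[OF this] consider "carrier (Deck (g ^^ k)) = rot ` {a. a ^ d = 1}"
        | b n where "b \<noteq> 0" "n \<in> {d, 2 * d}"
          "carrier (Deck (g ^^ k)) = rot ` {a. a ^ n = 1} \<union> (\<lambda>a. flip (a * b)) ` {a. a ^ n = 1}"
        unfolding carrier_Deck_iterate by blast
      then show ?thesis
      proof cases
        case 1
        note D = Deck_rotations[OF 1 d]
        show ?thesis
          using iso_trans[OF iso D(1)] D(2,3) bij_betw_finite[OF bij] bij_betw_same_card[OF bij]
          by simp
      next
        case 2
        have "n > 0"
          using 2(2) d by auto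
        note D = Deck_rotations_flips[OF 2(3) this 2(1)]
        show ?thesis
          using iso_trans[OF iso D(1)] D(2,3) bij_betw_finite[OF bij] bij_betw_same_card[OF bij] 2(2)
          by auto
      qed
    qed
    show ?thesis
      using main by (metis order_refl)
  qed
qed

end
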